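(* Let $G$ be a finite simple graph with vertex set $X$. Then $$\xi_{C^*}(G)\ge\sqrt{\frac{|X|}{\theta(G)}},$$ where $\theta(G)$ is the Lovász number of $G$. Moreover, $\xi_{C^*}(K_{d^2})=d$ for every $d\in\mathbb{N}$, where $K_{d^2}$ is the complete graph on $d^2$ vertices.
   Context: Write $x\sim y$ if $\{x,y\}$ is an edge of $G$. For a finite set $A$, $\mathcal{B}(\varphi_G^A)$ is the universal unital C*-algebra generated by matrix unit systems $(e_{x,a,a'})_{a,a'\in A}$, $x\in X$ (that is, $e_{x,a,b}e_{x,c,d}=\delta_{b,c}e_{x,a,d}$, $e_{x,a,b}^*=e_{x,b,a}$, $\sum_{a\in A}e_{x,a,a}=1$), subject to the relations $\sum_{a,b\in A}e_{x,a,b}e_{y,b,a}=0$ whenever $x\sim y$. Equivalently, it is the quotient of the C*-algebraic free product, amalgamated over the units, of $|X|$ copies of $M_A$ (complex $A\times A$ matrices) by the closed two-sided ideal generated by the elements $\sum_{a,b\in A}e_{x,a,b}e_{y,b,a}$, $x\sim y$; it may be $\{0\}$. The C*-algebraic orthogonal rank $\xi_{C^*}(G)$ is the smallest cardinality of a (non-empty) finite set $A$ for which $\mathcal{B}(\varphi_G^A)\neq\{0\}$; if no such $A$ exists, $\xi_{C^*}(G)=\infty$. *)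

theory Defs
  imports
    Complex_Main
    "HOL-Library.Poly_Mapping"
    "HOL-Library.Extended_Nat"
    "HOL-Library.Extended_Real"
    "HOL-Algebra.Module"
    "Jordan_Normal_Form.Matrix"
    "Graph_Theory.Graph_Theory"
begin

section \<open>Free unital *-algebras\<close>

datatype 'g letter = Gen 'g | Adj 'g

primrec adj_letter :: "'g letter \<Rightarrow> 'g letter" where
  "adj_letter (Gen g) = Adj g"
| "adj_letter (Adj g) = Gen g"

text \<open>
  The free monoid, written additively so that the ring structure of \<^theory>\<open>HOL-Library.Poly_Mapping\<close>
  on finitely supported functions is the (non-commutative) monoid algebra, i.e. the algebra of
  non-commutative polynomials in the letters.
\<close>

datatype 'g word = Word (letters: "'g letter list")

instantiation word :: (type) monoid_add
begin

definition zero_word :: "'a word" where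
  "0 = Word []"

definition plus_word :: "'a word \<Rightarrow> 'a word \<Rightarrow> 'a word" where
  "v + w = Word (letters v @ letters w)"

instance
  by standard (simp_all add: zero_word_def plus_word_def)

end

type_synonym 'g star_poly = "'g word \<Rightarrow>\<^sub>0 complex"

definition gen :: "'g \<Rightarrow> 'g star_poly" where
  "gen g = Poly_Mapping.single (Word [Gen g]) 1"

definition scale_poly :: "complex \<Rightarrow> 'g star_poly \<Rightarrow> 'g star_poly" where
  "scale_poly c u = Poly_Mapping.single 0 c * u"

definition adj_word :: "'g word \<Rightarrow> 'g word" where
  "adj_word w = Word (rev (map adj_letter (letters w)))"

definition adj_poly :: "'g star_poly \<Rightarrow> 'g star_poly" where
  "adj_poly u =
    (\<Sum>w\<in>Poly_Mapping.keys u. Poly_Mapping.single (adj_word w) (cnj (Poly_Mapping.lookup u w)))"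

definition free_star_algebra :: "'g set \<Rightarrow> 'g star_poly set" where
  "free_star_algebra S =
    {u. \<forall>w\<in>Poly_Mapping.keys u. set (letters w) \<subseteq> Gen ` S \<union> Adj ` S}"


section \<open>The universal unital C*-algebra on generators and relations\<close>

text \<open>
  The generators are \<open>S\<close> and the relations are \<open>r = 0\<close> for \<open>r \<in> R\<close>.  The universal C*-algebra is the
  separated completion of the free unital *-algebra on \<open>S\<close> for the largest C*-seminorm that vanishes
  on \<open>R\<close> (equivalently, on the *-ideal generated by \<open>R\<close>).
\<close>

definition cstar_seminorm_on :: "'g set \<Rightarrow> ('g star_poly \<Rightarrow> real) \<Rightarrow> bool" where
  "cstar_seminorm_on S q \<longleftrightarrow>
    (\<forall>u\<in>free_star_algebra S. \<forall>v\<in>free_star_algebra S.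
      q (u + v) \<le> q u + q v \<and> q (u * v) \<le> q u * q v) \<and>
    (\<forall>u\<in>free_star_algebra S.
      0 \<le> q u \<and> (\<forall>c. q (scale_poly c u) = cmod c * q u) \<and> q (adj_poly u * u) = (q u)\<^sup>2)"

text \<open>
  The supremum is over a non-empty set (it contains the zero seminorm), but it is meaningful only if
  the relations bound every generator.  Matrix units have norm at most 1 in every C*-seminorm.
\<close>

definition universal_seminorm :: "'g set \<Rightarrow> 'g star_poly set \<Rightarrow> 'g star_poly \<Rightarrow> real" where
  "universal_seminorm S R u = (SUP q\<in>{q. cstar_seminorm_on S q \<and> (\<forall>r\<in>R. q r = 0)}. q u)"

definition cauchy_seqs :: "'g set \<Rightarrow> 'g star_poly set \<Rightarrow> (nat \<Rightarrow> 'g star_poly) set" where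
  "cauchy_seqs S R =
    {s. range s \<subseteq> free_star_algebra S \<and>
      (\<forall>\<epsilon>>0. \<exists>N. \<forall>m\<ge>N. \<forall>n\<ge>N. universal_seminorm S R (s m - s n) < \<epsilon>)}"

definition cauchy_rel :: "'g set \<Rightarrow> 'g star_poly set \<Rightarrow> (nat \<Rightarrow> 'g star_poly) rel" where
  "cauchy_rel S R =
    {(s, t). s \<in> cauchy_seqs S R \<and> t \<in> cauchy_seqs S R \<and>
      (\<lambda>n. universal_seminorm S R (s n - t n)) \<longlonglongrightarrow> 0}"

definition cauchy_class ::
  "'g set \<Rightarrow> 'g star_poly set \<Rightarrow> (nat \<Rightarrow> 'g star_poly) \<Rightarrow> (nat \<Rightarrow> 'g star_poly) set" where
  "cauchy_class S R s = cauchy_rel S R `` {s}"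

record 'b normed_star_algebra = "(complex, 'b) module" +
  adjoint :: "'b \<Rightarrow> 'b"
  alg_norm :: "'b \<Rightarrow> real"

definition universal_cstar_algebra ::
  "'g set \<Rightarrow> 'g star_poly set \<Rightarrow> (nat \<Rightarrow> 'g star_poly) set normed_star_algebra" where
  "universal_cstar_algebra S R = \<lparr>
    carrier = cauchy_seqs S R // cauchy_rel S R,
    monoid.mult = (\<lambda>X Y. \<Union>s\<in>X. \<Union>t\<in>Y. cauchy_class S R (\<lambda>n. s n * t n)),
    one = cauchy_class S R (\<lambda>n. 1),
    zero = cauchy_class S R (\<lambda>n. 0),
    add = (\<lambda>X Y. \<Union>s\<in>X. \<Union>t\<in>Y. cauchy_class S R (\<lambda>n. s n + t n)),
    smult = (\<lambda>c X. \<Union>s\<in>X. cauchy_class S R (\<lambda>n. scale_poly c (s n))),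
    adjoint = (\<lambda>X. \<Union>s\<in>X. cauchy_class S R (\<lambda>n. adj_poly (s n))),
    alg_norm = (\<lambda>X. THE r. \<forall>s\<in>X. (\<lambda>n. universal_seminorm S R (s n)) \<longlonglongrightarrow> r)
  \<rparr>"


section \<open>The C*-algebra of a graph and the C*-algebraic orthogonal rank\<close>

text \<open>
  Finite simple graphs are the symmetric loop-free digraphs without multiple arcs of the locale
  \<^locale>\<open>graph\<close>.
\<close>

definition matrix_gens :: "('v, 'e) pre_digraph \<Rightarrow> 'i set \<Rightarrow> ('v \<times> 'i \<times> 'i) set" where
  "matrix_gens G A = verts G \<times> A \<times> A"

definition matrix_unit_relators ::
  "('v, 'e) pre_digraph \<Rightarrow> 'i set \<Rightarrow> ('v \<times> 'i \<times> 'i) star_poly set" where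
  "matrix_unit_relators G A =
    {gen (x, a, b) * gen (x, c, d) - (if b = c then gen (x, a, d) else 0) | x a b c d.
      x \<in> verts G \<and> a \<in> A \<and> b \<in> A \<and> c \<in> A \<and> d \<in> A} \<union>
    {adj_poly (gen (x, a, b)) - gen (x, b, a) | x a b. x \<in> verts G \<and> a \<in> A \<and> b \<in> A} \<union>
    {(\<Sum>a\<in>A. gen (x, a, a)) - 1 | x. x \<in> verts G}"

definition orthogonality_relators ::
  "('v, 'e) pre_digraph \<Rightarrow> 'i set \<Rightarrow> ('v \<times> 'i \<times> 'i) star_poly set" where
  "orthogonality_relators G A =
    {\<Sum>a\<in>A. \<Sum>b\<in>A. gen (x, a, b) * gen (y, b, a) | x y.
      x \<in> verts G \<and> y \<in> verts G \<and> x \<rightarrow>\<^bsub>G\<^esub> y}"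

definition graph_cstar_algebra ::
  "('v, 'e) pre_digraph \<Rightarrow> 'i set \<Rightarrow>
    (nat \<Rightarrow> ('v \<times> 'i \<times> 'i) star_poly) set normed_star_algebra" where
  "graph_cstar_algebra G A =
    universal_cstar_algebra (matrix_gens G A)
      (matrix_unit_relators G A \<union> orthogonality_relators G A)"

text \<open>
  Up to isomorphism the algebra depends only on the cardinality of the index set, so finite sets of
  natural numbers suffice.  The infimum of the empty set is \<open>\<infinity>\<close>.
\<close>

definition cstar_orthogonal_rank :: "('v, 'e) pre_digraph \<Rightarrow> enat" where
  "cstar_orthogonal_rank G =
    Inf {enat (card A) | A :: nat set. finite A \<and> A \<noteq> {} \<and>
      carrier (graph_cstar_algebra G A) \<noteq> {\<zero>\<^bsub>graph_cstar_algebra G A\<^esub>}}"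


section \<open>The Lov\'asz number\<close>

definition orthonormal_representation ::
  "('v, 'e) pre_digraph \<Rightarrow> nat \<Rightarrow> ('v \<Rightarrow> real vec) \<Rightarrow> bool" where
  "orthonormal_representation G N u \<longleftrightarrow>
    (\<forall>x\<in>verts G. u x \<in> carrier_vec N \<and> scalar_prod (u x) (u x) = 1) \<and>
    (\<forall>x\<in>verts G. \<forall>y\<in>verts G. x \<noteq> y \<and> \<not> x \<rightarrow>\<^bsub>G\<^esub> y \<longrightarrow> scalar_prod (u x) (u y) = 0)"

text \<open>
  Lov\'asz's original definition, with adjacent vertices as the confusable ones, so that complete
  graphs have Lov\'asz number 1.  A handle \<open>c\<close> orthogonal to some \<open>u x\<close> has value \<open>\<infinity>\<close> and is left out;
  in HOL the quotient would be 0.  For the graph without vertices the value is unspecified.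
\<close>

definition lovasz_number :: "('v, 'e) pre_digraph \<Rightarrow> real" where
  "lovasz_number G =
    Inf {Max ((\<lambda>x. 1 / (scalar_prod c (u x))\<^sup>2) ` verts G) | N c u.
      orthonormal_representation G N u \<and> c \<in> carrier_vec N \<and> scalar_prod c c = 1 \<and>
      (\<forall>x\<in>verts G. scalar_prod c (u x) \<noteq> 0)}"

end

theory Submission
  imports Defs "HOL-Analysis.L2_Norm" "HOL-Number_Theory.Cong"
begin

text \<open>
  Lower bound: let \<open>u\<close> be an orthonormal representation with handle \<open>c\<close>.  In the Hilbert module
  \<open>\<real>\<^sup>N \<otimes> B\<^bsup>A\<times>A\<^esup>\<close> the vectors \<open>u\<^sub>x \<otimes> (e\<^bsub>x,a,b\<^esub>)\<^bsub>a,b\<^esub>\<close> are pairwise orthogonal of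
  squared norm \<open>|A|\<close>: the first factors are orthogonal for non-adjacent vertices, the second ones for
  adjacent vertices.  Bessel's inequality for the vector \<open>c \<otimes> (\<delta>\<^bsub>a,b\<^esub>)\<^bsub>a,b\<^esub>\<close> of squared norm \<open>|A|\<close>
  gives \<open>\<Sum>\<^sub>x (c \<bullet> u\<^sub>x)\<^sup>2 \<le> |A|\<^sup>2\<close>.  The Gram matrix is scalar, so only the fact that a negative
  scalar is not a sum of squares is needed.

  Equality for \<open>K\<close> with \<open>d\<^sup>2\<close> vertices: conjugating the matrix units of the \<open>d \<times> d\<close> matrices by the
  \<open>d\<^sup>2\<close> pairwise trace-orthogonal Weyl--Heisenberg unitaries gives a nonzero representation.
\<close>

section \<open>The free unital *-algebra\<close>

lemma star_poly_expand:
  fixes u :: "'g star_poly"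
  shows "(\<Sum>w\<in>Poly_Mapping.keys u. Poly_Mapping.single w (Poly_Mapping.lookup u w)) = u"
  by (rule poly_mapping_eqI)
    (simp add: lookup_sum lookup_single when_def sum.delta' in_keys_iff)

text \<open>Adjoints, products and the action on vectors are additive, so their laws only have to be
  checked on monomials.\<close>

lemma star_poly_induct [case_names single add]:
  fixes u :: "'g star_poly"
  assumes single: "\<And>w c. P (Poly_Mapping.single w c)"
    and add: "\<And>u v. P u \<Longrightarrow> P v \<Longrightarrow> P (u + v)"
  shows "P u"
proof -
  have "P 0"
    using single[of 0 0] by simp
  then have "P (\<Sum>w\<in>W. Poly_Mapping.single w (f w))" for W and f :: "_ \<Rightarrow> complex"
    by (induction W rule: infinite_finite_induct) (auto intro: single add)
  then show ?thesis
    by (metis star_poly_expand)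
qed

lemma adj_word_add: "adj_word (v + w) = adj_word w + adj_word v"
  by (simp add: adj_word_def plus_word_def)

lemma adj_letter_adj_letter [simp]: "adj_letter (adj_letter l) = l"
  by (cases l) auto

lemma adj_word_adj_word [simp]: "adj_word (adj_word w) = w"
  by (cases w) (simp add: adj_word_def rev_map comp_def)

lemma adj_word_0 [simp]: "adj_word 0 = 0"
  by (simp add: adj_word_def zero_word_def)

lemma adj_poly_single [simp]:
  "adj_poly (Poly_Mapping.single w c) = Poly_Mapping.single (adj_word w) (cnj c)"
  by (simp add: adj_poly_def)

lemma adj_poly_add: "adj_poly (u + v) = adj_poly u + adj_poly v"
  unfolding adj_poly_def
  by (rule setsum_keys_plus_distrib) (simp_all add: single_add)

lemma adj_poly_0 [simp]: "adj_poly 0 = 0"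
  by (simp add: adj_poly_def)

lemma adj_poly_uminus: "adj_poly (- u) = - adj_poly u"
  by (metis add.right_inverse adj_poly_0 adj_poly_add add_eq_0_iff)

lemma adj_poly_diff: "adj_poly (u - v) = adj_poly u - adj_poly v"
  by (metis adj_poly_add adj_poly_uminus diff_conv_add_uminus)

lemma adj_poly_sum: "adj_poly (\<Sum>i\<in>I. f i) = (\<Sum>i\<in>I. adj_poly (f i))"
  by (induction I rule: infinite_finite_induct) (simp_all add: adj_poly_add)

lemma adj_poly_mult: "adj_poly (u * v) = adj_poly v * adj_poly u"
proof (induction u rule: star_poly_induct)
  case (single w c)
  show ?case
    by (induction v rule: star_poly_induct)
      (simp_all add: mult_single adj_word_add adj_poly_add distrib_left distrib_right mult.commute)
qed (simp add: adj_poly_add distrib_left distrib_right)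

lemma adj_poly_adj_poly [simp]: "adj_poly (adj_poly u) = u"
  by (induction u rule: star_poly_induct) (simp_all add: adj_poly_add)

lemma adj_poly_1 [simp]: "adj_poly 1 = 1"
  by (metis adj_poly_single adj_word_0 complex_cnj_one single_one)

text \<open>The index \<open>0\<close> is the empty word, so this is a multiple of the unit, and
  left multiplication by it is \<open>scale_poly\<close>.\<close>

abbreviation scalar :: "complex \<Rightarrow> 'g star_poly" where
  "scalar c \<equiv> Poly_Mapping.single 0 c"

lemma scalar_mult_commute: "u * scalar c = scalar c * u"
  by (induction u rule: star_poly_induct)
    (simp_all add: mult_single distrib_left distrib_right mult.commute)

lemma scalar_mult_scalar: "scalar c * scalar d = scalar (c * d)"
  by (simp add: mult_single)

lemma scalar_sum: "scalar (\<Sum>i\<in>I. f i) = (\<Sum>i\<in>I. scalar (f i))"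
  by (induction I rule: infinite_finite_induct) (simp_all add: single_add)

lemma scalar_mult_mult_scalar_mult:
  "(scalar c * u) * (scalar d * v) = scalar (c * d) * (u * v)"
  by (metis mult.assoc scalar_mult_commute scalar_mult_scalar)

lemma free_star_algebra_iff:
  "u \<in> free_star_algebra S \<longleftrightarrow>
    Poly_Mapping.keys u \<subseteq> {w. set (letters w) \<subseteq> Gen ` S \<union> Adj ` S}"
  by (auto simp: free_star_algebra_def)

lemma free_star_algebra_single:
  "set (letters w) \<subseteq> Gen ` S \<union> Adj ` S \<Longrightarrow> Poly_Mapping.single w c \<in> free_star_algebra S"
  by (simp add: free_star_algebra_def)

lemma free_star_algebra_scalar [intro, simp]: "scalar c \<in> free_star_algebra S"
  by (simp add: free_star_algebra_single zero_word_def)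

lemma free_star_algebra_one [intro, simp]: "1 \<in> free_star_algebra S"
  by (metis free_star_algebra_scalar single_one)

lemma free_star_algebra_numeral [intro, simp]: "numeral k \<in> free_star_algebra S"
  by (metis free_star_algebra_scalar single_numeral)

lemma free_star_algebra_zero [intro, simp]: "0 \<in> free_star_algebra S"
  by (simp add: free_star_algebra_def)

lemma free_star_algebra_gen [intro, simp]: "g \<in> S \<Longrightarrow> gen g \<in> free_star_algebra S"
  by (simp add: free_star_algebra_single gen_def)

lemma free_star_algebra_add [intro, simp]:
  "u \<in> free_star_algebra S \<Longrightarrow> v \<in> free_star_algebra S \<Longrightarrow> u + v \<in> free_star_algebra S"
  using Poly_Mapping.keys_add[of u v] unfolding free_star_algebra_iff by blast

lemma free_star_algebra_sum [intro, simp]: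
  "(\<And>i. i \<in> I \<Longrightarrow> f i \<in> free_star_algebra S) \<Longrightarrow> (\<Sum>i\<in>I. f i) \<in> free_star_algebra S"
  by (induction I rule: infinite_finite_induct) simp_all

lemma free_star_algebra_mult [intro, simp]:
  assumes "u \<in> free_star_algebra S" "v \<in> free_star_algebra S"
  shows "u * v \<in> free_star_algebra S"
proof -
  have "set (letters (a + b)) \<subseteq> Gen ` S \<union> Adj ` S"
    if "a \<in> Poly_Mapping.keys u" "b \<in> Poly_Mapping.keys v" for a b
    using assms that by (auto simp: free_star_algebra_def plus_word_def)
  then show ?thesis
    using keys_mult[of u v] unfolding free_star_algebra_iff by blast
qed

lemma free_star_algebra_uminus [intro, simp]:
  "u \<in> free_star_algebra S \<Longrightarrow> - u \<in> free_star_algebra S"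
  using free_star_algebra_mult[OF free_star_algebra_scalar[of "- 1"], of u S]
  by (simp add: single_uminus)

lemma free_star_algebra_diff [intro, simp]:
  "u \<in> free_star_algebra S \<Longrightarrow> v \<in> free_star_algebra S \<Longrightarrow> u - v \<in> free_star_algebra S"
  using free_star_algebra_add[of u S "- v"] by simp

lemma free_star_algebra_adj [intro, simp]:
  assumes "u \<in> free_star_algebra S"
  shows "adj_poly u \<in> free_star_algebra S"
proof -
  have "adj_letter ` (Gen ` S \<union> Adj ` S) \<subseteq> Gen ` S \<union> Adj ` S"
    by auto
  then have "set (letters (adj_word w)) \<subseteq> Gen ` S \<union> Adj ` S"
    if "set (letters w) \<subseteq> Gen ` S \<union> Adj ` S" for w
    using image_mono[OF that, of adj_letter] by (simp add: adj_word_def)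
  then show ?thesis
    using assms unfolding adj_poly_def free_star_algebra_def
    by (intro free_star_algebra_sum[unfolded free_star_algebra_def]
        free_star_algebra_single[unfolded free_star_algebra_def]) blast
qed

section \<open>C*-seminorms\<close>

locale cstar_seminorm =
  fixes S :: "'g set" and q :: "'g star_poly \<Rightarrow> real"
  assumes cstar_seminorm_on: "cstar_seminorm_on S q"
begin

abbreviation \<A> :: "'g star_poly set" where
  "\<A> \<equiv> free_star_algebra S"

lemma q_add: "u \<in> \<A> \<Longrightarrow> v \<in> \<A> \<Longrightarrow> q (u + v) \<le> q u + q v"
  and q_mult: "u \<in> \<A> \<Longrightarrow> v \<in> \<A> \<Longrightarrow> q (u * v) \<le> q u * q v"
  and q_nonneg: "u \<in> \<A> \<Longrightarrow> 0 \<le> q u"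
  and q_scalar_mult: "u \<in> \<A> \<Longrightarrow> q (scalar c * u) = cmod c * q u"
  and q_cstar: "u \<in> \<A> \<Longrightarrow> q (adj_poly u * u) = (q u)\<^sup>2"
  using cstar_seminorm_on unfolding cstar_seminorm_on_def scale_poly_def by blast+

lemma q_zero [simp]: "q 0 = 0"
  using q_scalar_mult[of 0 0] by simp

lemma q_uminus [simp]: "u \<in> \<A> \<Longrightarrow> q (- u) = q u"
  using q_scalar_mult[of u "- 1"] by (simp add: single_uminus)

lemma q_diff: "u \<in> \<A> \<Longrightarrow> v \<in> \<A> \<Longrightarrow> q (u - v) \<le> q u + q v"
  using q_add[of u "- v"] by simp

lemma q_diff_commute: "u \<in> \<A> \<Longrightarrow> v \<in> \<A> \<Longrightarrow> q (u - v) = q (v - u)"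
  using q_uminus[of "u - v"] by simp

lemma q_sum: "(\<And>i. i \<in> I \<Longrightarrow> f i \<in> \<A>) \<Longrightarrow> q (\<Sum>i\<in>I. f i) \<le> (\<Sum>i\<in>I. q (f i))"
proof (induction I rule: infinite_finite_induct)
  case (insert i I)
  then show ?case
    using q_add[of "f i" "sum f I"] by fastforce
qed auto

text \<open>The C*-identity and submultiplicativity give
  \<open>(q v)\<^sup>2 \<le> q (adj_poly v) * q v\<close>. Cancelling \<open>q v\<close> bounds
  \<open>q v\<close> by the value at the adjoint; the same bound for the adjoint gives
  equality.\<close>

lemma q_adj [simp]:
  assumes "u \<in> \<A>"
  shows "q (adj_poly u) = q u"
proof -
  have le: "q v \<le> q (adj_poly v)" if v: "v \<in> \<A>" for v
  proof (cases "q v = 0")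
    case False
    then have "0 < q v"
      using q_nonneg[OF v] by simp
    moreover have "q v * q v \<le> q (adj_poly v) * q v"
      using q_cstar[OF v] q_mult[OF free_star_algebra_adj[OF v] v] by (simp add: power2_eq_square)
    ultimately show ?thesis
      by simp
  qed (simp add: q_nonneg v)
  show ?thesis
    using le[OF assms] le[of "adj_poly u"] assms by simp
qed

lemma q_one_cases: "q 1 = 0 \<or> q 1 = 1"
  using q_cstar[of 1] by (auto simp: power2_eq_square)

text \<open>\<open>q u \<le> q 1 * q u\<close> excludes \<open>q 1 = 0\<close>, and the C*-identity
  at 1 then leaves only the value 1. Hence nontriviality of a seminorm can be tested on the
  unit.\<close>

lemma q_one:
  assumes "u \<in> \<A>" "q u \<noteq> 0"
  shows "q 1 = 1"
  using q_one_cases q_mult[of 1 u] assms q_nonneg[of u] by auto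

lemma q_scalar: "q 1 = 1 \<Longrightarrow> q (scalar c) = cmod c"
  using q_scalar_mult[of 1 c] by simp

text \<open>Equality in the quotient by the null ideal of \<open>q\<close>, so that computations
  modulo the relations stay with polynomials instead of the completion. Membership in \<A> is
  included because the seminorm laws hold only there.\<close>

definition null_eq :: "'g star_poly \<Rightarrow> 'g star_poly \<Rightarrow> bool" (infix \<open>\<approx>\<close> 50) where
  "u \<approx> v \<longleftrightarrow> u \<in> \<A> \<and> v \<in> \<A> \<and> q (u - v) = 0"

lemma null_eq_refl: "u \<in> \<A> \<Longrightarrow> u \<approx> u"
  by (simp add: null_eq_def)

lemma null_eq_sym: "u \<approx> v \<Longrightarrow> v \<approx> u"
  by (simp add: null_eq_def q_diff_commute)

lemma null_eq_trans [trans]: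
  assumes "u \<approx> v" "v \<approx> w"
  shows "u \<approx> w"
proof -
  have "q ((u - v) + (v - w)) \<le> 0" "0 \<le> q (u - w)"
    using assms q_add[of "u - v" "v - w"] by (auto simp: null_eq_def q_nonneg)
  then show ?thesis
    using assms by (auto simp: null_eq_def)
qed

lemma null_eq_add:
  assumes "u \<approx> u'" "v \<approx> v'"
  shows "u + v \<approx> u' + v'"
proof -
  have "q ((u - u') + (v - v')) \<le> 0" "0 \<le> q ((u + v) - (u' + v'))"
    using assms q_add[of "u - u'" "v - v'"] by (auto simp: null_eq_def q_nonneg)
  then show ?thesis
    using assms by (auto simp: null_eq_def algebra_simps)
qed

lemma null_eq_mult_right:
  assumes "u \<approx> u'" "v \<in> \<A>"
  shows "u * v \<approx> u' * v"
proof -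
  have "q ((u - u') * v) \<le> 0"
    using assms q_mult[of "u - u'" v] by (simp add: null_eq_def)
  moreover have "0 \<le> q ((u - u') * v)"
    using assms by (simp add: null_eq_def q_nonneg)
  ultimately have "q ((u - u') * v) = 0"
    by (rule order.antisym)
  then show ?thesis
    using assms by (simp add: null_eq_def left_diff_distrib)
qed

lemma null_eq_mult_left:
  assumes "u \<approx> u'" "v \<in> \<A>"
  shows "v * u \<approx> v * u'"
proof -
  have "q (v * (u - u')) \<le> 0"
    using assms q_mult[of v "u - u'"] by (simp add: null_eq_def)
  moreover have "0 \<le> q (v * (u - u'))"
    using assms by (simp add: null_eq_def q_nonneg)
  ultimately have "q (v * (u - u')) = 0"
    by (rule order.antisym)
  then show ?thesis
    using assms by (simp add: null_eq_def right_diff_distrib)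
qed

lemma null_eq_uminus: "u \<approx> u' \<Longrightarrow> - u \<approx> - u'"
  using null_eq_mult_left[of u u' "scalar (- 1)"] by (simp add: single_uminus)

lemma null_eq_diff: "u \<approx> u' \<Longrightarrow> v \<approx> v' \<Longrightarrow> u - v \<approx> u' - v'"
  using null_eq_add[of u u' "- v" "- v'"] null_eq_uminus[of v v'] by simp

lemma null_eq_sum: "(\<And>i. i \<in> I \<Longrightarrow> f i \<approx> g i) \<Longrightarrow> (\<Sum>i\<in>I. f i) \<approx> (\<Sum>i\<in>I. g i)"
  by (induction I rule: infinite_finite_induct) (simp_all add: null_eq_add null_eq_refl)

lemma null_eq_q:
  assumes "u \<approx> v"
  shows "q u = q v"
proof -
  have "q ((u - v) + v) \<le> q v" "q ((v - u) + u) \<le> q u"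
    using assms q_add[of "u - v" v] q_add[of "v - u" u] null_eq_sym[OF assms]
    by (auto simp: null_eq_def)
  then show ?thesis
    by simp
qed

text \<open>
  The polynomial \<open>u = 2 + 2k + k\<^sup>2\<close> approximates \<open>2 exp k\<close>, which is twice a unitary: \<open>u\<^sup>* u = 4 + k\<^sup>4\<close>,
  and \<open>2 + k\<^sup>2\<close> is the real part of \<open>u\<close>.
\<close>

lemma q_skew_square:
  assumes k: "k \<in> \<A>" and skew: "adj_poly k = - k" and one: "q 1 = 1"
  shows "q (2 + k * k) \<le> 2 + (q k) ^ 4 / 4"
proof -
  define u where "u = 2 + 2 * k + k * k"
  have u: "u \<in> \<A>"
    using k by (simp add: u_def)
  have adj2: "adj_poly 2 = (2 :: 'g star_poly)"
    by (metis adj_poly_single adj_word_0 complex_cnj_numeral single_numeral)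
  have adj_u: "adj_poly u = 2 - 2 * k + k * k"
    by (simp add: u_def adj_poly_add adj_poly_mult skew adj2 mult_2 mult_2_right)
  have q_num: "q (numeral n * v) = numeral n * q v" if "v \<in> \<A>" for n v
    using q_scalar_mult[OF that, of "numeral n"] by simp
  have "adj_poly u * u = 4 + k * k * (k * k)"
    unfolding adj_u unfolding u_def by (simp add: algebra_simps mult_2 mult_2_right)
  then have "(q u)\<^sup>2 \<le> q 4 + q (k * k * (k * k))"
    using q_cstar[OF u] q_add[of 4 "k * k * (k * k)"] k by simp
  also have "q 4 = 4"
    using q_num[of 1 "num.Bit0 (num.Bit0 num.One)"] one by simp
  also have "q (k * k * (k * k)) \<le> q k ^ 4"
  proof -
    have "q (k * k) \<le> (q k)\<^sup>2"
      using q_mult[OF k k] by (simp add: power2_eq_square)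
    then have "q (k * k) * q (k * k) \<le> (q k)\<^sup>2 * (q k)\<^sup>2"
      by (intro mult_mono) (auto simp: q_nonneg k)
    then show ?thesis
      using q_mult[of "k * k" "k * k"] k by (simp flip: power_add)
  qed
  \<comment> \<open>The right-hand side is \<open>4 + q k ^ 4\<close> plus a square; a bound that is
    itself a square permits taking the root.\<close>
  also have "4 + q k ^ 4 \<le> (2 + q k ^ 4 / 4)\<^sup>2"
    by (simp add: power2_sum)
  finally have "q u \<le> 2 + q k ^ 4 / 4"
    by (rule power2_le_imp_le) (auto intro!: add_nonneg_nonneg)
  moreover have "2 * (2 + k * k) = adj_poly u + u"
    unfolding adj_u by (simp add: u_def algebra_simps mult_2)
  then have "2 * q (2 + k * k) \<le> 2 * q u"
    using q_num[of "2 + k * k" "num.Bit0 num.One"] q_add[of "adj_poly u" u] u k by simp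
  ultimately show ?thesis
    by simp
qed

text \<open>Up to the factors \<delta> and i\<delta>, the skew elements \<open>k\<close> and
  \<open>l\<close> are \<open>y - y*\<close> and \<open>y + y*\<close>. In
  \<open>k * k + l * l\<close> the terms \<open>y * y\<close> and their adjoints cancel, leaving
  \<open>-2 * \<delta>\<^sup>2\<close> times the symmetrized square, so two instances of
  \<open>q_skew_square\<close> add up to twice the claim.\<close>

lemma q_symmetrized_square:
  assumes y: "y \<in> \<A>" and one: "q 1 = 1" and d: "0 \<le> \<delta>"
  shows "q (2 - scalar (of_real (\<delta>\<^sup>2)) * (adj_poly y * y + y * adj_poly y)) \<le> 2 + 4 * \<delta> ^ 4 * q y ^ 4"
proof -
  define k where "k = scalar (of_real \<delta>) * (y - adj_poly y)"
  define l where "l = scalar (\<i> * of_real \<delta>) * (y + adj_poly y)"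
  have kA: "k \<in> \<A>" and lA: "l \<in> \<A>"
    using y by (auto simp: k_def l_def)
  have "adj_poly k = - k"
    by (simp add: k_def adj_poly_mult adj_poly_diff scalar_mult_commute right_diff_distrib)
  moreover have "adj_poly l = - l"
    by (simp add: l_def adj_poly_mult adj_poly_add scalar_mult_commute single_uminus algebra_simps)
  ultimately have "q (2 + k * k) \<le> 2 + q k ^ 4 / 4" "q (2 + l * l) \<le> 2 + q l ^ 4 / 4"
    using q_skew_square kA lA one by auto
  moreover have "q k \<le> 2 * \<delta> * q y" "q l \<le> 2 * \<delta> * q y"
    using mult_left_mono[OF q_diff[of y "adj_poly y"] d] mult_left_mono[OF q_add[of y "adj_poly y"] d] y d
    by (simp_all add: k_def l_def q_scalar_mult norm_mult mult_ac)
  then have "q k ^ 4 \<le> (2 * \<delta> * q y) ^ 4" "q l ^ 4 \<le> (2 * \<delta> * q y) ^ 4"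
    by (auto intro!: power_mono q_nonneg kA lA)
  ultimately have "q ((2 + k * k) + (2 + l * l)) \<le> 4 + 8 * \<delta> ^ 4 * q y ^ 4"
    using q_add[of "2 + k * k" "2 + l * l"] kA lA by (simp add: power_mult_distrib)
  also have "(2 + k * k) + (2 + l * l) =
      scalar 2 * (2 - scalar (of_real (\<delta>\<^sup>2)) * (adj_poly y * y + y * adj_poly y))"
  proof -
    have kk: "k * k = scalar (of_real (\<delta>\<^sup>2)) * ((y - adj_poly y) * (y - adj_poly y))"
      by (simp add: k_def scalar_mult_mult_scalar_mult power2_eq_square)
    have ll: "l * l = - (scalar (of_real (\<delta>\<^sup>2)) * ((y + adj_poly y) * (y + adj_poly y)))"
    proof -
      have "\<i> * of_real \<delta> * (\<i> * of_real \<delta>) = - complex_of_real (\<delta>\<^sup>2)"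
        by (simp add: complex_eq_iff power2_eq_square)
      then show ?thesis
        unfolding l_def scalar_mult_mult_scalar_mult by (simp add: single_uminus)
    qed
    show ?thesis
      unfolding kk ll by (simp add: algebra_simps mult_2 mult_2_right)
  qed
  finally show ?thesis
    using y by (subst (asm) q_scalar_mult) auto
qed

text \<open>
  Positivity of a general \<open>y\<^sup>* y\<close> needs functional calculus in the completion; adding \<open>y y\<^sup>*\<close>
  makes an elementary norm estimate sufficient.
\<close>

lemma symmetrized_sum_of_squares_nonneg:
  fixes r :: real
  assumes fin: "finite I" and y: "\<And>i. i \<in> I \<Longrightarrow> y i \<in> \<A>" and one: "q 1 = 1"
    and sum: "(\<Sum>i\<in>I. adj_poly (y i) * y i + y i * adj_poly (y i)) \<approx> scalar (of_real r)"
  shows "0 \<le> r"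
proof (rule ccontr)
  assume "\<not> 0 \<le> r"
  then have r: "r < 0"
    by simp
  define M where "M = (\<Sum>i\<in>I. 4 * q (y i) ^ 4)"
  have M: "0 \<le> M"
    unfolding M_def by (intro sum_nonneg) (simp add: q_nonneg y)
  have *: "- r \<le> \<epsilon> * M" if \<epsilon>: "0 < \<epsilon>" for \<epsilon>
  proof -
    define \<delta> where "\<delta> = sqrt \<epsilon>"
    have \<delta>: "0 \<le> \<delta>" "\<delta>\<^sup>2 = \<epsilon>"
      using \<epsilon> by (simp_all add: \<delta>_def)
    have \<delta>4: "\<delta> ^ 4 = \<epsilon>\<^sup>2"
      by (simp flip: \<delta>(2) power_mult)
    let ?z = "\<lambda>i. 2 - scalar (of_real \<epsilon>) * (adj_poly (y i) * y i + y i * adj_poly (y i))"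
    let ?n = "2 * real (card I)"
    have "(\<Sum>i\<in>I. ?z i) = scalar (of_real ?n) -
        scalar (of_real \<epsilon>) * (\<Sum>i\<in>I. adj_poly (y i) * y i + y i * adj_poly (y i))"
      by (simp add: sum_subtractf sum_distrib_left mult.commute flip: scalar_mult_scalar)
    also have "\<dots> \<approx> scalar (of_real ?n) - scalar (of_real \<epsilon>) * scalar (of_real r)"
      by (intro null_eq_diff null_eq_mult_left null_eq_refl sum) auto
    also have "\<dots> = scalar (of_real (?n - \<epsilon> * r))"
      by (simp add: scalar_mult_scalar flip: single_diff)
    finally have "q (\<Sum>i\<in>I. ?z i) = cmod (of_real (?n - \<epsilon> * r))"
      unfolding q_scalar[OF one, symmetric] by (rule null_eq_q)
    also have "\<dots> = ?n - \<epsilon> * r"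
      using mult_pos_neg[OF \<epsilon> r] unfolding norm_of_real by simp
    finally have "?n - \<epsilon> * r \<le> (\<Sum>i\<in>I. q (?z i))"
      using q_sum[of I ?z] y by simp
    also have "\<dots> \<le> (\<Sum>i\<in>I. 2 + \<epsilon>\<^sup>2 * (4 * q (y i) ^ 4))"
      using q_symmetrized_square[OF y one \<delta>(1)] by (intro sum_mono) (simp add: \<delta> \<delta>4 mult_ac)
    also have "\<dots> = ?n + \<epsilon>\<^sup>2 * M"
      by (simp add: sum.distrib M_def flip: sum_distrib_left)
    finally have "\<epsilon> * - r \<le> \<epsilon> * (\<epsilon> * M)"
      by (simp add: power2_eq_square mult.assoc)
    then show ?thesis
      using \<epsilon> by (rule mult_left_le_imp_le)
  qed
  \<comment> \<open>An \<epsilon> small enough for the contradiction; \<open>M + 1\<close> keeps the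
    denominator positive even if \<open>M = 0\<close>.\<close>
  have "(- r / (2 * (M + 1))) * M < - r"
    using M r by (simp add: field_simps) (smt (verit) mult_nonneg_nonpos mult.commute)
  then show False
    using *[of "- r / (2 * (M + 1))"] M r by (simp add: divide_neg_pos)
qed

end


section \<open>Trace forms of matrices over the free algebra\<close>

lemma sum_scalar_mult_product:
  fixes e :: "'x \<Rightarrow> 'a \<Rightarrow> 'a \<Rightarrow> 'g star_poly"
  shows "(\<Sum>a\<in>A. \<Sum>b\<in>A. (\<Sum>x\<in>V. scalar (f x) * e x a b) * (\<Sum>y\<in>V. scalar (f y) * e y b a)) =
    (\<Sum>x\<in>V. \<Sum>y\<in>V. scalar (f x * f y) * (\<Sum>a\<in>A. \<Sum>b\<in>A. e x a b * e y b a))"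
proof -
  have "(\<Sum>a\<in>A. \<Sum>b\<in>A. (\<Sum>x\<in>V. scalar (f x) * e x a b) * (\<Sum>y\<in>V. scalar (f y) * e y b a)) =
      (\<Sum>(a, b)\<in>A \<times> A. \<Sum>(x, y)\<in>V \<times> V. scalar (f x * f y) * (e x a b * e y b a))"
    by (simp add: sum_product scalar_mult_mult_scalar_mult flip: sum.cartesian_product)
  also have "\<dots> = (\<Sum>(x, y)\<in>V \<times> V. \<Sum>(a, b)\<in>A \<times> A. scalar (f x * f y) * (e x a b * e y b a))"
    unfolding case_prod_unfold by (rule sum.swap)
  also have "\<dots> = (\<Sum>x\<in>V. \<Sum>y\<in>V. scalar (f x * f y) * (\<Sum>a\<in>A. \<Sum>b\<in>A. e x a b * e y b a))"
    by (simp add: sum_distrib_left flip: sum.cartesian_product)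
  finally show ?thesis .
qed

text \<open>This is the trace of the square of \<open>r * 1 - W\<close> for an
  \<open>A \<times> A\<close> matrix \<open>W\<close> over the free algebra. Scalars are central, so
  the two cross terms agree and the binomial formula survives noncommutativity.\<close>

lemma sum_diagonal_minus_square:
  fixes W :: "'a \<Rightarrow> 'a \<Rightarrow> 'g star_poly"
  assumes "finite A"
  shows "(\<Sum>a\<in>A. \<Sum>b\<in>A. ((if a = b then scalar r else 0) - W a b) * ((if b = a then scalar r else 0) - W b a)) =
    scalar (of_nat (card A) * r\<^sup>2) - scalar (2 * r) * (\<Sum>a\<in>A. W a a) + (\<Sum>a\<in>A. \<Sum>b\<in>A. W a b * W b a)"
proof -
  have "((if a = b then scalar r else 0) - W a b) * ((if b = a then scalar r else 0) - W b a) =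
      (if a = b then scalar (r\<^sup>2) - scalar (2 * r) * W a a else 0) + W a b * W b a" for a b
  proof (cases "a = b")
    case True
    have "(scalar r - W a a) * (scalar r - W a a) =
        scalar r * scalar r - (scalar r * W a a + W a a * scalar r) + W a a * W a a"
      by (simp add: left_diff_distrib right_diff_distrib)
    also have "scalar r * W a a + W a a * scalar r = scalar (2 * r) * W a a"
      unfolding scalar_mult_commute[of "W a a"] mult_2 single_add distrib_right ..
    also have "scalar r * scalar r = (scalar (r\<^sup>2) :: 'g star_poly)"
      by (simp add: scalar_mult_scalar power2_eq_square)
    finally show ?thesis
      using True by simp
  qed simp
  moreover have "scalar (of_nat (card A) * r\<^sup>2) = of_nat (card A) * (scalar (r\<^sup>2) :: 'g star_poly)"
    by (simp flip: scalar_mult_scalar)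
  ultimately show ?thesis
    using assms by (simp add: sum.distrib sum.delta' sum_subtractf sum_distrib_left)
qed

section \<open>The Bessel inequality\<close>

text \<open>A single seminorm of this kind stands in for the nonzero graph algebra;
  \<open>universal_cstar_algebra_nontrivialD\<close> supplies it.\<close>

locale graph_cstar_seminorm = cstar_seminorm "matrix_gens G A" q
  for G :: "('v, 'e) pre_digraph" and A :: "'i set" and q +
  assumes null: "r \<in> matrix_unit_relators G A \<union> orthogonality_relators G A \<Longrightarrow> q r = 0"
    and one: "q 1 = 1"
    and fin: "finite (verts G)" "finite A" "A \<noteq> {}"
begin

notation null_eq (infix \<open>\<approx>\<close> 50)

lemma sum_handle_squares_le:
  assumes rep: "orthonormal_representation G N u"
    and c: "c \<in> carrier_vec N" "scalar_prod c c = 1"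
  shows "(\<Sum>x\<in>verts G. (scalar_prod c (u x))\<^sup>2) \<le> (real (card A))\<^sup>2"
proof -
  define V where "V = verts G"
  define D where "D = real (card A)"
  define t where "t x = scalar_prod c (u x)" for x
  define T where "T = (\<Sum>x\<in>V. (t x)\<^sup>2)"
  define e where "e x a b = gen (x, a, b)" for x :: 'v and a b :: 'i
  \<comment> \<open>Modulo the relations \<open>e y b a\<close> is the adjoint of
    \<open>e y a b\<close>, so \<open>P x y\<close> is the algebra-valued inner product of the
    matrices of matrix units at \<open>x\<close> and \<open>y\<close>.\<close>
  define P where "P x y = (\<Sum>a\<in>A. \<Sum>b\<in>A. e x a b * e y b a)" for x y
  \<comment> \<open>Coordinates of the Bessel residual: \<open>r k\<close> belongs to
    \<open>D\<close> times the handle vector, \<open>W k a b\<close> to the sum of the vectors at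
    \<open>x\<close> with coefficients \<open>t x\<close>. These are the projection coefficients
    \<open>t x / D\<close> after multiplying by \<open>D\<close> to clear denominators, and
    \<open>z\<close> is the difference.\<close>
  define f where "f k x = complex_of_real (t x * u x $ k)" for k x
  define r where "r k = complex_of_real (D * c $ k)" for k
  define W where "W k a b = (\<Sum>x\<in>V. scalar (f k x) * e x a b)" for k a b
  define z where "z k a b = (if a = b then scalar (r k) else 0) - W k a b" for k a b
  have D: "0 < D"
    using fin by (simp add: D_def card_gt_0_iff)
  have eA: "e x a b \<in> \<A>" if "x \<in> V" "a \<in> A" "b \<in> A" for x a b
    using that by (auto simp: e_def V_def matrix_gens_def)
  have WA: "W k a b \<in> \<A>" if "a \<in> A" "b \<in> A" for k a b
    using that by (auto simp: W_def intro!: eA)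
  have zA: "z k a b \<in> \<A>" if "a \<in> A" "b \<in> A" for k a b
    using that WA by (auto simp: z_def)
  have PA: "P x y \<in> \<A>" if "x \<in> V" "y \<in> V" for x y
    using that by (auto simp: P_def intro!: eA)

  have e_mult: "e x a b * e x b a \<approx> e x a a" if "x \<in> V" "a \<in> A" "b \<in> A" for x a b
  proof -
    have "e x a b * e x b a - (if b = b then e x a a else 0) \<in> matrix_unit_relators G A"
      using that unfolding matrix_unit_relators_def e_def V_def by blast
    then show ?thesis
      using null that by (auto simp: null_eq_def eA)
  qed
  have e_adj: "adj_poly (e x a b) \<approx> e x b a" if "x \<in> V" "a \<in> A" "b \<in> A" for x a b
  proof -
    have "adj_poly (e x a b) - e x b a \<in> matrix_unit_relators G A"
      using that unfolding matrix_unit_relators_def e_def V_def by blast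
    then show ?thesis
      using null that by (auto simp: null_eq_def eA)
  qed
  have e_sum: "(\<Sum>a\<in>A. e x a a) \<approx> 1" if "x \<in> V" for x
  proof -
    have "(\<Sum>a\<in>A. e x a a) - 1 \<in> matrix_unit_relators G A"
      using that unfolding matrix_unit_relators_def e_def V_def by blast
    then show ?thesis
      using null that by (auto simp: null_eq_def eA)
  qed
  have P_diag: "P x x \<approx> scalar (of_real D)" if "x \<in> V" for x
  proof -
    have "P x x \<approx> (\<Sum>a\<in>A. \<Sum>b\<in>A. e x a a)"
      unfolding P_def by (intro null_eq_sum e_mult that)
    also have "\<dots> = scalar (of_real D) * (\<Sum>a\<in>A. e x a a)"
      by (simp add: D_def sum_distrib_left)
    also have "\<dots> \<approx> scalar (of_real D) * 1"
      by (intro null_eq_mult_left e_sum that) simp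
    finally show ?thesis
      by simp
  qed
  have P_adj: "P x y \<approx> 0" if "x \<in> V" "y \<in> V" "x \<rightarrow>\<^bsub>G\<^esub> y" for x y
  proof -
    have "P x y \<in> orthogonality_relators G A"
      using that unfolding orthogonality_relators_def P_def e_def V_def by blast
    then show ?thesis
      using null that by (auto simp: null_eq_def PA)
  qed
  have cu: "(\<Sum>k<N. c $ k * u x $ k) = t x" if "x \<in> V" for x
    using rep that by (auto simp: t_def scalar_prod_def orthonormal_representation_def V_def atLeast0LessThan)
  have uu: "(\<Sum>k<N. u x $ k * u y $ k) = scalar_prod (u x) (u y)" if "y \<in> V" for x y
    using rep that by (auto simp: scalar_prod_def orthonormal_representation_def V_def atLeast0LessThan)
  have cc: "(\<Sum>k<N. c $ k * c $ k) = 1"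
    using c by (auto simp: scalar_prod_def atLeast0LessThan)

  \<comment> \<open>The squared handle part, the cross terms and the squared projection part
    contribute \<open>D ^ 3\<close>, \<open>- 2 * D * T\<close> and \<open>D * T\<close>.\<close>
  have gram: "(\<Sum>k<N. \<Sum>a\<in>A. \<Sum>b\<in>A. z k a b * z k b a) \<approx> scalar (of_real (D * (D\<^sup>2 - T)))"
  proof -
    have "(\<Sum>k<N. \<Sum>a\<in>A. \<Sum>b\<in>A. z k a b * z k b a) =
        (\<Sum>k<N. scalar (of_nat (card A) * (r k)\<^sup>2)) - (\<Sum>k<N. scalar (2 * r k) * (\<Sum>a\<in>A. W k a a))
        + (\<Sum>k<N. \<Sum>a\<in>A. \<Sum>b\<in>A. W k a b * W k b a)"
      unfolding z_def by (simp add: sum_diagonal_minus_square[OF fin(2)] sum.distrib sum_subtractf)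
    also have "(\<Sum>k<N. scalar (of_nat (card A) * (r k)\<^sup>2)) = scalar (of_real (D ^ 3))"
    proof -
      have "(\<Sum>k<N. of_nat (card A) * (r k)\<^sup>2) = of_real (\<Sum>k<N. D ^ 3 * (c $ k * c $ k))"
        by (simp add: r_def D_def power2_eq_square power3_eq_cube mult_ac)
      then show ?thesis
        by (simp only: cc flip: scalar_sum sum_distrib_left) simp
    qed
    also have "(\<Sum>k<N. scalar (2 * r k) * (\<Sum>a\<in>A. W k a a)) =
        (\<Sum>x\<in>V. scalar (of_real (2 * D * (t x)\<^sup>2)) * (\<Sum>a\<in>A. e x a a))"
    proof -
      have "(\<Sum>k<N. scalar (2 * r k) * (\<Sum>a\<in>A. W k a a)) =
          (\<Sum>k<N. \<Sum>x\<in>V. scalar (2 * r k * f k x) * (\<Sum>a\<in>A. e x a a))"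
        unfolding W_def sum.swap[of _ _ A]
        by (simp add: sum_distrib_left mult.assoc[symmetric] scalar_mult_scalar)
      also have "\<dots> = (\<Sum>x\<in>V. scalar (\<Sum>k<N. 2 * r k * f k x) * (\<Sum>a\<in>A. e x a a))"
        unfolding scalar_sum sum_distrib_right by (rule sum.swap)
      also have "\<dots> = (\<Sum>x\<in>V. scalar (of_real (2 * D * (t x)\<^sup>2)) * (\<Sum>a\<in>A. e x a a))"
      proof (rule sum.cong[OF refl])
        fix x assume x: "x \<in> V"
        have "(\<Sum>k<N. 2 * r k * f k x) = of_real (\<Sum>k<N. 2 * D * t x * (c $ k * u x $ k))"
          by (simp add: r_def f_def mult_ac)
        also have "\<dots> = of_real (2 * D * (t x)\<^sup>2)"
          unfolding sum_distrib_left[symmetric] cu[OF x] by (simp add: power2_eq_square)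
        finally show "scalar (\<Sum>k<N. 2 * r k * f k x) * (\<Sum>a\<in>A. e x a a) =
            scalar (of_real (2 * D * (t x)\<^sup>2)) * (\<Sum>a\<in>A. e x a a)"
          by simp
      qed
      finally show ?thesis .
    qed
    also have "(\<Sum>k<N. \<Sum>a\<in>A. \<Sum>b\<in>A. W k a b * W k b a) =
        (\<Sum>x\<in>V. \<Sum>y\<in>V. scalar (of_real (t x * t y * scalar_prod (u x) (u y))) * P x y)"
    proof -
      have "(\<Sum>k<N. \<Sum>a\<in>A. \<Sum>b\<in>A. W k a b * W k b a) =
          (\<Sum>k<N. \<Sum>x\<in>V. \<Sum>y\<in>V. scalar (f k x * f k y) * P x y)"
        unfolding W_def P_def by (simp add: sum_scalar_mult_product)
      also have "\<dots> = (\<Sum>x\<in>V. \<Sum>y\<in>V. \<Sum>k<N. scalar (f k x * f k y) * P x y)"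
        by (subst sum.swap) (intro sum.cong refl sum.swap)
      also have "\<dots> = (\<Sum>x\<in>V. \<Sum>y\<in>V. scalar (of_real (t x * t y * scalar_prod (u x) (u y))) * P x y)"
      proof (intro sum.cong refl)
        fix x y assume y: "y \<in> V"
        have "(\<Sum>k<N. f k x * f k y) = of_real (\<Sum>k<N. t x * t y * (u x $ k * u y $ k))"
          by (simp add: f_def mult_ac)
        also have "\<dots> = of_real (t x * t y * scalar_prod (u x) (u y))"
          unfolding sum_distrib_left[symmetric] uu[OF y] by simp
        finally show "(\<Sum>k<N. scalar (f k x * f k y) * P x y) =
            scalar (of_real (t x * t y * scalar_prod (u x) (u y))) * P x y"
          by (simp flip: sum_distrib_right scalar_sum)
      qed
      finally show ?thesis .
    qed
    \<comment> \<open>The equalities so far hold in the free algebra; here the relations enter. Off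
      the diagonal every term vanishes: \<open>P x y\<close> is a relator for adjacent vertices, and
      \<open>scalar_prod (u x) (u y)\<close> is 0 for the others.\<close>
    also have "scalar (of_real (D ^ 3)) -
          (\<Sum>x\<in>V. scalar (of_real (2 * D * (t x)\<^sup>2)) * (\<Sum>a\<in>A. e x a a)) +
          (\<Sum>x\<in>V. \<Sum>y\<in>V. scalar (of_real (t x * t y * scalar_prod (u x) (u y))) * P x y) \<approx>
        scalar (of_real (D ^ 3)) - (\<Sum>x\<in>V. scalar (of_real (2 * D * (t x)\<^sup>2)) * 1) +
          (\<Sum>x\<in>V. \<Sum>y\<in>V. if y = x then scalar (of_real (D * (t x)\<^sup>2)) else 0)"
    proof (intro null_eq_add null_eq_diff null_eq_sum null_eq_mult_left e_sum)
      fix x y assume x: "x \<in> V" and y: "y \<in> V"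
      let ?p = "scalar (of_real (t x * t y * scalar_prod (u x) (u y))) * P x y"
      show "?p \<approx> (if y = x then scalar (of_real (D * (t x)\<^sup>2)) else 0)"
      proof (cases "y = x")
        case True
        have "scalar_prod (u x) (u x) = 1"
          using rep x by (simp add: orthonormal_representation_def V_def)
        then have "?p = scalar (of_real ((t x)\<^sup>2)) * P x x"
          using True by (simp add: power2_eq_square)
        also have "\<dots> \<approx> scalar (of_real ((t x)\<^sup>2)) * scalar (of_real D)"
          by (intro null_eq_mult_left P_diag x) simp
        also have "\<dots> = scalar (of_real (D * (t x)\<^sup>2))"
          by (simp add: scalar_mult_scalar mult.commute)
        finally show ?thesis
          using True by simp
      next
        case False
        show ?thesis
        proof (cases "x \<rightarrow>\<^bsub>G\<^esub> y")
          case True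
          then have "?p \<approx> scalar (of_real (t x * t y * scalar_prod (u x) (u y))) * 0"
            by (intro null_eq_mult_left P_adj x y) simp_all
          then show ?thesis
            using False by simp
        next
          case nadj: False
          then have "scalar_prod (u x) (u y) = 0"
            using rep x y False by (simp add: orthonormal_representation_def V_def)
          then show ?thesis
            using False by (simp add: null_eq_refl)
        qed
      qed
    qed (auto intro: null_eq_refl)
    also have "\<dots> = scalar (of_real (D * (D\<^sup>2 - T)))"
    proof -
      have "(\<Sum>x\<in>V. \<Sum>y\<in>V. if y = x then scalar (of_real (D * (t x)\<^sup>2)) else 0) =
          (scalar (of_real (D * T)) :: ('v \<times> 'i \<times> 'i) star_poly)"
        using fin by (simp add: V_def T_def sum_distrib_left sum.delta flip: scalar_sum)
      moreover have "(\<Sum>x\<in>V. scalar (of_real (2 * D * (t x)\<^sup>2)) * 1) =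
          (scalar (of_real (2 * D * T)) :: ('v \<times> 'i \<times> 'i) star_poly)"
        by (simp add: T_def sum_distrib_left flip: scalar_sum)
      ultimately show ?thesis
        by (simp add: algebra_simps power2_eq_square power3_eq_cube flip: single_add single_diff)
    qed
    finally show ?thesis .
  qed

  \<comment> \<open>The handle and the representation are real, so all coefficients are fixed by
    conjugation and each matrix \<open>z k\<close> is self-adjoint modulo the relations.\<close>
  have z_adj: "adj_poly (z k a b) \<approx> z k b a" if "a \<in> A" "b \<in> A" for k a b
  proof -
    have "adj_poly (z k a b) =
        (if b = a then scalar (r k) else 0) - (\<Sum>x\<in>V. scalar (f k x) * adj_poly (e x a b))"
      by (simp add: z_def W_def adj_poly_diff adj_poly_sum adj_poly_mult scalar_mult_commute r_def f_def)
    also have "\<dots> \<approx> z k b a"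
      unfolding z_def W_def
      by (intro null_eq_diff null_eq_sum null_eq_mult_left e_adj that null_eq_refl) auto
    finally show ?thesis .
  qed
  define I where "I = {..<N} \<times> A \<times> A"
  define y where "y = (\<lambda>(k, a, b). z k a b)"
  have "(\<Sum>i\<in>I. adj_poly (y i) * y i + y i * adj_poly (y i)) =
      (\<Sum>k<N. \<Sum>a\<in>A. \<Sum>b\<in>A. adj_poly (z k a b) * z k a b + z k a b * adj_poly (z k a b))"
    by (simp add: I_def y_def sum.cartesian_product case_prod_unfold)
  also have "\<dots> \<approx> (\<Sum>k<N. \<Sum>a\<in>A. \<Sum>b\<in>A. z k b a * z k a b + z k a b * z k b a)"
    by (intro null_eq_sum null_eq_add null_eq_mult_left null_eq_mult_right z_adj zA)
  \<comment> \<open>Interchanging \<open>a\<close> and \<open>b\<close> turns one half of the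
    symmetrized sum into the other, so symmetrizing merely doubles the Gram sum.\<close>
  also have "\<dots> = (\<Sum>k<N. \<Sum>a\<in>A. \<Sum>b\<in>A. z k a b * z k b a) + (\<Sum>k<N. \<Sum>a\<in>A. \<Sum>b\<in>A. z k a b * z k b a)"
    by (simp add: sum.distrib sum.swap[of "\<lambda>a b. z _ b a * z _ a b"])
  also have "\<dots> \<approx> scalar (of_real (D * (D\<^sup>2 - T))) + scalar (of_real (D * (D\<^sup>2 - T)))"
    by (intro null_eq_add gram)
  also have "\<dots> = scalar (of_real (2 * (D * (D\<^sup>2 - T))))"
    by (simp flip: single_add)
  finally have "0 \<le> 2 * (D * (D\<^sup>2 - T))"
    by (rule symmetrized_sum_of_squares_nonneg[rotated 3])
      (use fin zA one in \<open>auto simp: I_def y_def\<close>)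
  then have "T \<le> D\<^sup>2"
    using D by (simp add: zero_le_mult_iff)
  then show ?thesis
    by (simp add: T_def t_def D_def V_def)
qed

end

section \<open>Operator seminorms of matrix representations\<close>

text \<open>Vectors are total functions; only their values on the finite index set \<open>J\<close> matter.\<close>

locale matrix_representation =
  fixes J :: "'j set" and M :: "'g \<Rightarrow> 'j \<Rightarrow> 'j \<Rightarrow> complex"
  assumes finite_J: "finite J"
begin

text \<open>Adjoint letters act by the conjugate transpose, so an arbitrary choice of matrices
  \<open>M\<close> yields a *-representation of the free algebra; relations appear later as elements
  of operator norm 0.\<close>

definition letter_apply :: "'g letter \<Rightarrow> ('j \<Rightarrow> complex) \<Rightarrow> 'j \<Rightarrow> complex" where
  "letter_apply l x i =
    (\<Sum>j\<in>J. (case l of Gen g \<Rightarrow> M g i j | Adj g \<Rightarrow> cnj (M g j i)) * x j)"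

definition word_apply :: "'g letter list \<Rightarrow> ('j \<Rightarrow> complex) \<Rightarrow> 'j \<Rightarrow> complex" where
  "word_apply ls = foldr letter_apply ls"

definition poly_apply :: "'g star_poly \<Rightarrow> ('j \<Rightarrow> complex) \<Rightarrow> 'j \<Rightarrow> complex" where
  "poly_apply u x i =
    (\<Sum>w\<in>Poly_Mapping.keys u. Poly_Mapping.lookup u w * word_apply (letters w) x i)"

lemma word_apply_simps [simp]:
  "word_apply [] x = x"
  "word_apply (l # ls) x = letter_apply l (word_apply ls x)"
  by (simp_all add: word_apply_def)

lemma word_apply_append: "word_apply (ks @ ls) x = word_apply ks (word_apply ls x)"
  by (simp add: word_apply_def)

lemma letter_apply_add: "letter_apply l (\<lambda>i. x i + y i) = (\<lambda>i. letter_apply l x i + letter_apply l y i)"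
  by (simp add: letter_apply_def fun_eq_iff distrib_left sum.distrib)

lemma letter_apply_scale: "letter_apply l (\<lambda>i. c * x i) = (\<lambda>i. c * letter_apply l x i)"
  by (simp add: letter_apply_def fun_eq_iff sum_distrib_left mult_ac)

lemma word_apply_add: "word_apply ls (\<lambda>i. x i + y i) = (\<lambda>i. word_apply ls x i + word_apply ls y i)"
  by (induction ls) (simp_all add: letter_apply_add)

lemma word_apply_scale: "word_apply ls (\<lambda>i. c * x i) = (\<lambda>i. c * word_apply ls x i)"
  by (induction ls) (simp_all add: letter_apply_scale)

lemma poly_apply_single [simp]:
  "poly_apply (Poly_Mapping.single w c) x = (\<lambda>i. c * word_apply (letters w) x i)"
  by (simp add: poly_apply_def fun_eq_iff)

lemma poly_apply_add: "poly_apply (u + v) x = (\<lambda>i. poly_apply u x i + poly_apply v x i)"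
proof
  show "poly_apply (u + v) x i = poly_apply u x i + poly_apply v x i" for i
    unfolding poly_apply_def by (rule setsum_keys_plus_distrib) (simp_all add: distrib_right)
qed

lemma poly_apply_0 [simp]: "poly_apply 0 x = (\<lambda>i. 0)"
  by (simp add: poly_apply_def fun_eq_iff)

lemma poly_apply_1 [simp]: "poly_apply 1 x = x"
  unfolding single_one[symmetric] poly_apply_single by (simp add: zero_word_def)

lemma poly_apply_diff: "poly_apply (u - v) x = (\<lambda>i. poly_apply u x i - poly_apply v x i)"
  using poly_apply_add[of "u - v" v x] by (simp add: fun_eq_iff)

lemma poly_apply_sum: "poly_apply (\<Sum>k\<in>K. f k) x = (\<lambda>i. \<Sum>k\<in>K. poly_apply (f k) x i)"
  by (induction K rule: infinite_finite_induct) (simp_all add: poly_apply_add)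

lemma poly_apply_scale: "poly_apply u (\<lambda>i. c * x i) = (\<lambda>i. c * poly_apply u x i)"
  by (simp add: poly_apply_def word_apply_scale fun_eq_iff sum_distrib_left mult_ac)

lemma poly_apply_mult: "poly_apply (u * v) x = poly_apply u (poly_apply v x)"
proof (induction u rule: star_poly_induct)
  case (single w c)
  show ?case
    by (induction v rule: star_poly_induct)
      (simp_all add: mult_single plus_word_def word_apply_append poly_apply_add word_apply_add
        word_apply_scale distrib_left fun_eq_iff)
qed (simp add: poly_apply_add distrib_right)

lemma poly_apply_gen: "poly_apply (gen g) x i = (\<Sum>j\<in>J. M g i j * x j)"
  by (simp add: gen_def letter_apply_def)

lemma poly_apply_adj_gen: "poly_apply (adj_poly (gen g)) x i = (\<Sum>j\<in>J. cnj (M g j i) * x j)"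
  by (simp add: gen_def adj_word_def letter_apply_def)

section \<open>Inner product, norm and adjoints\<close>

definition ip :: "('j \<Rightarrow> complex) \<Rightarrow> ('j \<Rightarrow> complex) \<Rightarrow> complex" where
  "ip x y = (\<Sum>i\<in>J. cnj (x i) * y i)"

definition nv :: "('j \<Rightarrow> complex) \<Rightarrow> real" where
  "nv x = L2_set (\<lambda>i. cmod (x i)) J"

lemma ip_scale: "ip x (\<lambda>i. c * y i) = c * ip x y"
  by (simp add: ip_def sum_distrib_left mult_ac)

lemma ip_letter_apply: "ip (letter_apply (adj_letter l) x) y = ip x (letter_apply l y)"
proof -
  have "ip (letter_apply (adj_letter l) x) y =
      (\<Sum>i\<in>J. \<Sum>j\<in>J. cnj (x j) * (case l of Gen g \<Rightarrow> M g j i | Adj g \<Rightarrow> cnj (M g i j)) * y i)"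
    by (cases l) (simp_all add: ip_def letter_apply_def sum_distrib_left sum_distrib_right mult_ac)
  also have "\<dots> = ip x (letter_apply l y)"
    by (subst sum.swap) (simp add: ip_def letter_apply_def sum_distrib_left mult.assoc)
  finally show ?thesis .
qed

lemma ip_word_apply:
  "ip (word_apply (rev (map adj_letter ls)) x) y = ip x (word_apply ls y)"
  by (induction ls arbitrary: x) (simp_all add: word_apply_append ip_letter_apply)

lemma ip_poly_apply: "ip (poly_apply (adj_poly u) x) y = ip x (poly_apply u y)"
proof (induction u rule: star_poly_induct)
  case (single w c)
  have "ip (\<lambda>i. cnj c * z i) y = c * ip z y" for z
    by (simp add: ip_def sum_distrib_left mult_ac)
  then show ?case
    by (simp add: ip_word_apply adj_word_def ip_scale)
qed (simp add: poly_apply_add adj_poly_add ip_def distrib_left distrib_right sum.distrib)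

lemma nv_nonneg [simp]: "0 \<le> nv x"
  by (simp add: nv_def)

lemma nv_triangle: "nv (\<lambda>i. x i + y i) \<le> nv x + nv y"
  unfolding nv_def
  by (rule order.trans[OF L2_set_mono L2_set_triangle_ineq]) (auto intro: norm_triangle_ineq)

lemma nv_scale: "nv (\<lambda>i. c * x i) = cmod c * nv x"
  by (simp add: nv_def norm_mult L2_set_right_distrib)

lemma nv_zero [simp]: "nv (\<lambda>i. 0) = 0"
  by (simp add: nv_def L2_set_def)

lemma nv_power2: "(nv x)\<^sup>2 = cmod (ip x x)"
proof -
  have "ip x x = of_real (\<Sum>i\<in>J. (cmod (x i))\<^sup>2)"
    unfolding ip_def of_real_sum complex_norm_square by (simp add: mult.commute)
  then show ?thesis
    unfolding nv_def L2_set_def by (simp only: norm_of_real) (simp add: sum_nonneg)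
qed

lemma ip_le: "cmod (ip x y) \<le> nv x * nv y"
proof -
  have "cmod (ip x y) \<le> (\<Sum>i\<in>J. \<bar>cmod (x i)\<bar> * \<bar>cmod (y i)\<bar>)"
    unfolding ip_def by (rule order.trans[OF norm_sum]) (simp add: norm_mult)
  also have "\<dots> \<le> nv x * nv y"
    unfolding nv_def by (rule L2_set_mult_ineq)
  finally show ?thesis .
qed

text \<open>A crude bound by the sum of the moduli of all entries suffices, since it only serves to
  make the supremum in \<open>op_norm\<close> finite.\<close>

lemma letter_apply_bounded: "\<exists>C\<ge>0. \<forall>x. nv (letter_apply l x) \<le> C * nv x"
proof -
  define A where "A i j = (case l of Gen g \<Rightarrow> M g i j | Adj g \<Rightarrow> cnj (M g j i))" for i j
  have "nv (letter_apply l x) \<le> (\<Sum>i\<in>J. \<Sum>j\<in>J. cmod (A i j)) * nv x" for x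
  proof -
    have "nv (letter_apply l x) \<le> (\<Sum>i\<in>J. cmod (letter_apply l x i))"
      unfolding nv_def by (rule L2_set_le_sum) simp
    also have "\<dots> \<le> (\<Sum>i\<in>J. \<Sum>j\<in>J. cmod (A i j) * cmod (x j))"
      unfolding letter_apply_def A_def[symmetric]
      by (intro sum_mono order.trans[OF norm_sum]) (simp add: norm_mult)
    also have "\<dots> \<le> (\<Sum>i\<in>J. \<Sum>j\<in>J. cmod (A i j) * nv x)"
      unfolding nv_def using finite_J
      by (intro sum_mono mult_left_mono member_le_L2_set) auto
    finally show ?thesis
      by (simp add: sum_distrib_right)
  qed
  then show ?thesis
    by (intro exI[of _ "\<Sum>i\<in>J. \<Sum>j\<in>J. cmod (A i j)"]) (auto intro!: sum_nonneg)
qed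

lemma word_apply_bounded: "\<exists>C\<ge>0. \<forall>x. nv (word_apply ls x) \<le> C * nv x"
proof (induction ls)
  case Nil
  show ?case
    by (intro exI[of _ 1]) simp
next
  case (Cons l ls)
  then obtain C D where "C \<ge> 0" "\<And>x. nv (word_apply ls x) \<le> C * nv x"
    "D \<ge> 0" "\<And>x. nv (letter_apply l x) \<le> D * nv x"
    using letter_apply_bounded[of l] by blast
  then have "nv (word_apply (l # ls) x) \<le> D * (C * nv x)" for x
    using \<open>D \<ge> 0\<close> by (auto intro: order.trans[OF _ mult_left_mono])
  then show ?case
    using \<open>C \<ge> 0\<close> \<open>D \<ge> 0\<close> by (intro exI[of _ "D * C"]) (simp add: mult.assoc)
qed

lemma poly_apply_bounded: "\<exists>C\<ge>0. \<forall>x. nv (poly_apply u x) \<le> C * nv x"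
proof (induction u rule: star_poly_induct)
  case (single w c)
  obtain C where C: "C \<ge> 0" "\<And>x. nv (word_apply (letters w) x) \<le> C * nv x"
    using word_apply_bounded by blast
  then show ?case
    by (intro exI[of _ "cmod c * C"]) (simp add: nv_scale mult.assoc mult_left_mono)
next
  case (add u v)
  then obtain C D where "C \<ge> 0" "\<And>x. nv (poly_apply u x) \<le> C * nv x"
    "D \<ge> 0" "\<And>x. nv (poly_apply v x) \<le> D * nv x"
    by blast
  then have "nv (poly_apply (u + v) x) \<le> (C + D) * nv x" for x
    unfolding poly_apply_add distrib_right
    by (intro order.trans[OF nv_triangle] add_mono)
  then show ?case
    using \<open>C \<ge> 0\<close> \<open>D \<ge> 0\<close> by (intro exI[of _ "C + D"]) simp
qed

definition op_norm :: "'g star_poly \<Rightarrow> real" where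
  "op_norm u = (SUP x\<in>{x. nv x \<le> 1}. nv (poly_apply u x))"

lemma op_norm_upper:
  assumes "nv x \<le> 1"
  shows "nv (poly_apply u x) \<le> op_norm u"
proof -
  obtain C where C: "C \<ge> 0" "\<And>x. nv (poly_apply u x) \<le> C * nv x"
    using poly_apply_bounded by blast
  have "nv (poly_apply u x) \<le> C" if "nv x \<le> 1" for x
    using C(2)[of x] mult_left_mono[OF that C(1)] by simp
  then have "bdd_above ((\<lambda>x. nv (poly_apply u x)) ` {x. nv x \<le> 1})"
    by (intro bdd_aboveI2) auto
  then show ?thesis
    unfolding op_norm_def using assms by (intro cSUP_upper) auto
qed

lemma op_norm_nonneg: "0 \<le> op_norm u"
  using op_norm_upper[of "\<lambda>i. 0" u] by (simp add: order.trans[OF nv_nonneg])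

lemma nv_poly_apply_le: "nv (poly_apply u x) \<le> op_norm u * nv x"
proof (cases "nv x = 0")
  \<comment> \<open>Such an \<open>x\<close> vanishes on \<open>J\<close> but may be nonzero
    elsewhere and cannot be normalised; boundedness with any constant forces the image to have norm
    0.\<close>
  case True
  obtain C where "\<And>x. nv (poly_apply u x) \<le> C * nv x"
    using poly_apply_bounded by blast
  from this[of x] show ?thesis
    using True by simp
next
  case False
  then have pos: "0 < nv x"
    using nv_nonneg[of x] by linarith
  have "nv (poly_apply u (\<lambda>i. of_real (inverse (nv x)) * x i)) \<le> op_norm u"
    by (rule op_norm_upper) (simp only: nv_scale norm_of_real, use pos in simp)
  then have "inverse (nv x) * nv (poly_apply u x) \<le> op_norm u"
    using pos unfolding poly_apply_scale nv_scale norm_of_real by simp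
  then show ?thesis
    using pos by (simp add: field_simps)
qed

lemma op_norm_le:
  assumes "0 \<le> C" "\<And>x. nv (poly_apply u x) \<le> C * nv x"
  shows "op_norm u \<le> C"
  unfolding op_norm_def
proof (rule cSUP_least)
  show "{x. nv x \<le> 1} \<noteq> {}"
    using nv_zero by (metis (mono_tags) empty_Collect_eq zero_le_one)
  show "nv (poly_apply u x) \<le> C" if "x \<in> {x. nv x \<le> 1}" for x
    using assms(2)[of x] mult_left_mono[of "nv x" 1 C] that assms(1) by simp
qed

lemma op_norm_add: "op_norm (u + v) \<le> op_norm u + op_norm v"
proof (rule op_norm_le)
  show "nv (poly_apply (u + v) x) \<le> (op_norm u + op_norm v) * nv x" for x
    unfolding poly_apply_add distrib_right
    by (intro order.trans[OF nv_triangle] add_mono nv_poly_apply_le)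
qed (simp add: op_norm_nonneg)

lemma op_norm_mult: "op_norm (u * v) \<le> op_norm u * op_norm v"
proof (rule op_norm_le)
  show "nv (poly_apply (u * v) x) \<le> op_norm u * op_norm v * nv x" for x
    unfolding poly_apply_mult mult.assoc
    by (intro order.trans[OF nv_poly_apply_le] mult_left_mono nv_poly_apply_le op_norm_nonneg)
qed (simp add: op_norm_nonneg)

text \<open>One inequality is immediate from homogeneity of \<open>nv\<close>; for nonzero
  \<open>c\<close> the other is the same inequality for \<open>inverse c\<close>.\<close>

lemma op_norm_scalar_mult: "op_norm (scalar c * u) = cmod c * op_norm u"
proof -
  have le: "op_norm (scalar c * u) \<le> cmod c * op_norm u" for c u
  proof (rule op_norm_le)
    show "nv (poly_apply (scalar c * u) x) \<le> cmod c * op_norm u * nv x" for x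
      by (simp add: poly_apply_mult zero_word_def nv_scale mult.assoc mult_left_mono nv_poly_apply_le)
  qed (simp add: op_norm_nonneg)
  show ?thesis
  proof (cases "c = 0")
    case True
    then show ?thesis
      using le[of 0 u] op_norm_nonneg[of 0] by simp
  next
    case False
    have "scalar (inverse c) * (scalar c * u) = u"
      using False by (simp add: scalar_mult_scalar flip: mult.assoc)
    then have "op_norm u \<le> inverse (cmod c) * op_norm (scalar c * u)"
      using le[of "inverse c" "scalar c * u"] by (simp add: norm_inverse)
    then have "cmod c * op_norm u \<le> op_norm (scalar c * u)"
      using False by (simp add: field_simps)
    then show ?thesis
      using le[of c u] by simp
  qed
qed

text \<open>Moving the adjoint across the inner product turns the squared norm of \<open>?y\<close>
  into the inner product of \<open>x\<close> with the image of \<open>?y\<close> under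
  \<open>u\<close>. Cauchy-Schwarz then allows one factor \<open>nv ?y\<close> to be
  cancelled.\<close>

lemma op_norm_adj_le: "op_norm (adj_poly u) \<le> op_norm u"
proof (rule op_norm_le)
  fix x
  let ?y = "poly_apply (adj_poly u) x"
  have "(nv ?y)\<^sup>2 = cmod (ip x (poly_apply u ?y))"
    by (simp add: nv_power2 ip_poly_apply)
  also have "\<dots> \<le> nv x * (op_norm u * nv ?y)"
    by (rule order.trans[OF ip_le]) (simp add: mult_left_mono nv_poly_apply_le)
  finally have "nv ?y * nv ?y \<le> (op_norm u * nv x) * nv ?y"
    by (simp add: power2_eq_square mult_ac)
  then show "nv ?y \<le> op_norm u * nv x"
    using op_norm_nonneg[of u] nv_nonneg[of x] nv_nonneg[of ?y]
    by (cases "nv ?y = 0") (simp_all add: mult_le_cancel_right)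
qed (simp add: op_norm_nonneg)

lemma op_norm_cstar: "op_norm (adj_poly u * u) = (op_norm u)\<^sup>2"
proof (rule order.antisym)
  have "op_norm (adj_poly u * u) \<le> op_norm (adj_poly u) * op_norm u"
    by (rule op_norm_mult)
  also have "\<dots> \<le> (op_norm u)\<^sup>2"
    by (simp add: power2_eq_square mult_right_mono op_norm_adj_le op_norm_nonneg)
  finally show "op_norm (adj_poly u * u) \<le> (op_norm u)\<^sup>2" .
  have "op_norm u \<le> sqrt (op_norm (adj_poly u * u))"
  proof (rule op_norm_le)
    fix x
    have "(nv (poly_apply u x))\<^sup>2 = cmod (ip (poly_apply (adj_poly u * u) x) x)"
      by (simp add: nv_power2 ip_poly_apply poly_apply_mult)
    also have "\<dots> \<le> op_norm (adj_poly u * u) * nv x * nv x"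
      by (rule order.trans[OF ip_le]) (simp add: mult_right_mono nv_poly_apply_le)
    also have "\<dots> = (sqrt (op_norm (adj_poly u * u)) * nv x)\<^sup>2"
      by (simp add: power_mult_distrib op_norm_nonneg power2_eq_square)
    finally show "nv (poly_apply u x) \<le> sqrt (op_norm (adj_poly u * u)) * nv x"
      by (rule power2_le_imp_le) (simp add: op_norm_nonneg)
  qed (simp add: op_norm_nonneg)
  then show "(op_norm u)\<^sup>2 \<le> op_norm (adj_poly u * u)"
    using op_norm_nonneg real_le_rsqrt sqrt_ge_absD by fastforce
qed

lemma cstar_seminorm_on_op_norm: "cstar_seminorm_on S op_norm"
  unfolding cstar_seminorm_on_def scale_poly_def
  by (auto simp: op_norm_add op_norm_mult op_norm_nonneg op_norm_scalar_mult op_norm_cstar)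

text \<open>Restricting to coordinates in \<open>J\<close> is essential for the relator of the unit:
  \<open>poly_apply 1\<close> is the identity on total functions, whereas sums over \<open>J\<close>
  reproduce a vector only at indices in \<open>J\<close>.\<close>

lemma op_norm_eq_0:
  assumes "\<And>x i. i \<in> J \<Longrightarrow> poly_apply u x i = 0"
  shows "op_norm u = 0"
proof (rule order.antisym)
  show "op_norm u \<le> 0"
    using assms by (intro op_norm_le) (simp_all add: nv_def L2_set_def)
qed (rule op_norm_nonneg)

lemma op_norm_1_neq_0:
  assumes "J \<noteq> {}"
  shows "op_norm 1 \<noteq> 0"
proof -
  obtain j where j: "j \<in> J"
    using assms by blast
  have "nv (\<lambda>i. of_bool (i = j)) = 1"
  proof -
    have "(\<Sum>i\<in>J. (cmod (of_bool (i = j)))\<^sup>2) = (\<Sum>i\<in>J. if i = j then 1 else 0)"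
      by (intro sum.cong) auto
    then show ?thesis
      using j finite_J by (simp add: nv_def L2_set_def)
  qed
  then show ?thesis
    using nv_poly_apply_le[of 1 "\<lambda>i. of_bool (i = j)"] by auto
qed

end

section \<open>Orthogonal unitaries\<close>

text \<open>
  Trace-orthogonal unitaries \<open>U\<^sub>x\<close> represent the matrix units by \<open>U\<^sub>x E\<^bsub>ab\<^esub> U\<^sub>x\<^sup>*\<close>, because
  \<open>\<Sum>\<^bsub>a,b\<^esub> E\<^bsub>ab\<^esub> X E\<^bsub>ba\<^esub>\<close> is the trace of \<open>X\<close> times the identity.
\<close>

lemma ex_seminorm_of_orthogonal_unitaries:
  fixes G :: "('v, 'e) pre_digraph" and A :: "'i set" and U :: "'v \<Rightarrow> 'i \<Rightarrow> 'i \<Rightarrow> complex"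
  assumes A: "finite A" "A \<noteq> {}"
    and cols: "\<And>x a b. x \<in> verts G \<Longrightarrow> a \<in> A \<Longrightarrow> b \<in> A \<Longrightarrow>
      (\<Sum>i\<in>A. cnj (U x i a) * U x i b) = of_bool (a = b)"
    and rows: "\<And>x i j. x \<in> verts G \<Longrightarrow> i \<in> A \<Longrightarrow> j \<in> A \<Longrightarrow>
      (\<Sum>a\<in>A. U x i a * cnj (U x j a)) = of_bool (i = j)"
    and orth: "\<And>x y. x \<in> verts G \<Longrightarrow> y \<in> verts G \<Longrightarrow> x \<rightarrow>\<^bsub>G\<^esub> y \<Longrightarrow>
      (\<Sum>b\<in>A. \<Sum>i\<in>A. cnj (U x i b) * U y i b) = 0"
  obtains q where "cstar_seminorm_on (matrix_gens G A) q"
    "\<And>r. r \<in> matrix_unit_relators G A \<union> orthogonality_relators G A \<Longrightarrow> q r = 0" "q 1 \<noteq> 0"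
proof -
  \<comment> \<open>The entry at \<open>(i, j)\<close> of \<open>U x\<close> times the matrix unit
    at \<open>(a, b)\<close> times the adjoint of \<open>U x\<close>: a rank-one operator built from
    columns \<open>a\<close> and \<open>b\<close>.\<close>
  interpret matrix_representation A "\<lambda>(x, a, b) i j. U x i a * cnj (U x j b)"
    by standard (rule A(1))
  have gen_apply: "poly_apply (gen (x, a, b)) v = (\<lambda>i. ip (\<lambda>j. U x j b) v * U x i a)" for x a b v
    by (simp add: fun_eq_iff poly_apply_gen ip_def sum_distrib_left mult_ac)
  have mult_apply: "poly_apply (gen (x, a, b) * gen (y, c, d)) v i =
      ip (\<lambda>j. U x j b) (\<lambda>j. U y j c) * (ip (\<lambda>j. U y j d) v * U x i a)" for x y a b c d v i
    by (simp add: poly_apply_mult gen_apply ip_scale)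
  have units: "op_norm r = 0" if "r \<in> matrix_unit_relators G A" for r
  proof (rule op_norm_eq_0)
    fix v i assume i: "i \<in> A"
    show "poly_apply r v i = 0"
      using that unfolding matrix_unit_relators_def
    proof (elim UnE CollectE exE conjE)
      fix x a b c d assume "r = gen (x, a, b) * gen (x, c, d) - (if b = c then gen (x, a, d) else 0)"
        "x \<in> verts G" "a \<in> A" "b \<in> A" "c \<in> A" "d \<in> A"
      then show ?thesis
        using cols[of x b c] by (simp add: poly_apply_diff mult_apply gen_apply ip_def)
    next
      fix x a b assume "r = adj_poly (gen (x, a, b)) - gen (x, b, a)"
      then show ?thesis
        by (simp add: poly_apply_diff poly_apply_adj_gen gen_apply ip_def sum_distrib_left mult_ac)
    next
      fix x assume r: "r = (\<Sum>a\<in>A. gen (x, a, a)) - 1" and x: "x \<in> verts G"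
      have "poly_apply (\<Sum>a\<in>A. gen (x, a, a)) v i = (\<Sum>a\<in>A. \<Sum>j\<in>A. U x i a * cnj (U x j a) * v j)"
        by (simp add: poly_apply_sum gen_apply ip_def sum_distrib_left mult_ac)
      also have "\<dots> = (\<Sum>j\<in>A. (\<Sum>a\<in>A. U x i a * cnj (U x j a)) * v j)"
        by (subst sum.swap) (simp add: sum_distrib_right)
      also have "\<dots> = (\<Sum>j\<in>A. of_bool (i = j) * v j)"
        by (intro sum.cong refl) (simp add: rows x i)
      also have "\<dots> = v i"
        using A(1) i by simp
      finally show ?thesis
        by (simp add: r poly_apply_diff)
    qed
  qed
  have "op_norm r = 0" if "r \<in> orthogonality_relators G A" for r
  proof (rule op_norm_eq_0)
    fix v i
    obtain x y where r: "r = (\<Sum>a\<in>A. \<Sum>b\<in>A. gen (x, a, b) * gen (y, b, a))"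
      and xy: "x \<in> verts G" "y \<in> verts G" "x \<rightarrow>\<^bsub>G\<^esub> y"
      using \<open>r \<in> orthogonality_relators G A\<close> unfolding orthogonality_relators_def by blast
    \<comment> \<open>The inner sum over \<open>b\<close> is the trace of the adjoint of
      \<open>U x\<close> times \<open>U y\<close>; it is independent of \<open>a\<close> and is 0 by
      \<open>orth\<close>.\<close>
    have "poly_apply r v i =
        (\<Sum>a\<in>A. (\<Sum>b\<in>A. ip (\<lambda>j. U x j b) (\<lambda>j. U y j b)) * (ip (\<lambda>j. U y j a) v * U x i a))"
      by (simp add: r poly_apply_sum mult_apply sum_distrib_right)
    also have "\<dots> = 0"
      using orth[OF xy] by (simp add: ip_def)
    finally show "poly_apply r v i = 0" .
  qed
  with units show ?thesis
    using that[OF cstar_seminorm_on_op_norm] op_norm_1_neq_0[OF A(2)] by blast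
qed

section \<open>Weyl-Heisenberg unitaries\<close>

lemma add_mod_inj:
  fixes a b s d :: nat
  assumes "a < d" "b < d" "(a + s) mod d = (b + s) mod d"
  shows "a = b"
proof -
  have "[a + s = b + s] (mod d)"
    using assms(3) by (simp add: cong_def)
  then show ?thesis
    using assms(1,2) by (simp add: cong_add_rcancel_nat cong_less_modulus_unique_nat)
qed

text \<open>The Weyl--Heisenberg unitaries: a cyclic shift by \<open>s\<close> after a diagonal matrix of powers of a root of unity.\<close>

definition weyl :: "nat \<Rightarrow> nat \<times> nat \<Rightarrow> nat \<Rightarrow> nat \<Rightarrow> complex" where
  "weyl d = (\<lambda>(s, t) i a. if i = (a + s) mod d then cis (2 * pi * real t / real d) ^ a else 0)"

lemma cnj_cis_power_mult: "cnj (cis x) ^ n * cis x ^ n = 1" "cis x ^ n * cnj (cis x) ^ n = 1"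
  by (simp_all add: cis_cnj cis_mult flip: power_mult_distrib)

text \<open>Column \<open>a\<close> has its only nonzero entry, of modulus 1, in row
  \<open>(a + s) mod d\<close>, and distinct columns use distinct rows.\<close>

lemma weyl_cols:
  assumes "a < d" "b < d"
  shows "(\<Sum>i<d. cnj (weyl d p i a) * weyl d p i b) = of_bool (a = b)"
proof (cases p)
  case (Pair s t)
  have "(\<Sum>i<d. cnj (weyl d p i a) * weyl d p i b) =
      (\<Sum>i<d. if i = (a + s) mod d then of_bool (a = b) else 0)"
    using add_mod_inj[of a d b s] assms
    by (intro sum.cong refl) (auto simp: weyl_def Pair cnj_cis_power_mult)
  then show ?thesis
    using assms by simp
qed

lemma weyl_rows:
  assumes "i < d" "j < d"
  shows "(\<Sum>a<d. weyl d p i a * cnj (weyl d p j a)) = of_bool (i = j)"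
proof (cases p)
  case (Pair s t)
  have inj: "inj_on (\<lambda>a. (a + s) mod d) {..<d}"
    by (intro inj_onI) (rule add_mod_inj[of _ d _ s], auto)
  moreover have "(\<lambda>a. (a + s) mod d) ` {..<d} \<subseteq> {..<d}"
    using assms by auto
  ultimately have bij: "bij_betw (\<lambda>a. (a + s) mod d) {..<d} {..<d}"
    by (simp add: bij_betw_def endo_inj_surj)
  have "(\<Sum>a<d. weyl d p i a * cnj (weyl d p j a)) =
      (\<Sum>a<d. if (a + s) mod d = i then of_bool (i = j) else 0)"
    by (intro sum.cong refl) (auto simp: weyl_def Pair cnj_cis_power_mult)
  also have "\<dots> = (\<Sum>k<d. if k = i then of_bool (i = j) else 0)"
    by (rule sum.reindex_bij_betw[OF bij])
  finally show ?thesis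
    using assms by simp
qed

text \<open>For different shifts the supports are disjoint. For equal shifts the products of entries
  are the powers of a quotient of two distinct d-th roots of unity, and their geometric sum is
  0.\<close>

lemma weyl_trace_orthogonal:
  assumes "p \<in> {..<d} \<times> {..<d}" "p' \<in> {..<d} \<times> {..<d}" "p \<noteq> p'"
  shows "(\<Sum>a<d. \<Sum>i<d. cnj (weyl d p i a) * weyl d p' i a) = 0"
proof -
  obtain s t s' t' where p: "p = (s, t)" "p' = (s', t')" and lt: "s < d" "t < d" "s' < d" "t' < d"
    using assms by auto
  show ?thesis
  proof (cases "s = s'")
    case False
    then have "(a + s) mod d \<noteq> (a + s') mod d" for a
      using add_mod_inj[OF lt(1,3), of a] by (auto simp: add.commute)
    from this this[symmetric] show ?thesis
      by (auto simp: weyl_def p intro!: sum.neutral)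
  next
    case True
    define \<zeta> where "\<zeta> k = cis (2 * pi * real k / real d)" for k
    define z where "z = cnj (\<zeta> t) * \<zeta> t'"
    have d: "d > 0"
      using lt by simp
    have bij: "bij_betw \<zeta> {..<d} {z. z ^ d = 1}"
      using bij_betw_roots_unity[OF d] by (simp add: \<zeta>_def[abs_def])
    have "\<zeta> t ^ d = 1" "\<zeta> t' ^ d = 1"
      using bij_betwE[OF bij] lt by auto
    then have "z ^ d = 1"
      by (simp add: z_def power_mult_distrib flip: complex_cnj_power)
    moreover have "z \<noteq> 1"
    proof
      assume "z = 1"
      then have "\<zeta> t' = \<zeta> t"
        using cnj_cis_power_mult(2)[of _ 1] unfolding z_def \<zeta>_def
        by (metis mult.assoc mult.commute mult_1 power_one_right)
      then have "t' = t"
        using bij_betw_imp_inj_on[OF bij] lt by (auto dest: inj_onD)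
      then show False
        using assms(3) True p by simp
    qed
    ultimately have "(\<Sum>a<d. z ^ a) = 0"
      by (simp add: geometric_sum)
    moreover have "(\<Sum>i<d. cnj (weyl d p i a) * weyl d p' i a) = z ^ a" for a
    proof -
      have "(\<Sum>i<d. cnj (weyl d p i a) * weyl d p' i a) = (\<Sum>i<d. if i = (a + s) mod d then z ^ a else 0)"
        using True by (intro sum.cong refl) (auto simp: weyl_def p z_def \<zeta>_def power_mult_distrib)
      then show ?thesis
        using d by simp
    qed
    ultimately show ?thesis
      by simp
  qed
qed

section \<open>Nontriviality of the universal C*-algebra\<close>

text \<open>Without such a \<open>q\<close> every admissible seminorm vanishes by
  \<open>q_one\<close>. Then the universal seminorm is 0, all sequences are Cauchy and equivalent,
  and only the zero class remains.\<close>

lemma universal_cstar_algebra_nontrivialD: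
  assumes "carrier (universal_cstar_algebra S R) \<noteq> {\<zero>\<^bsub>universal_cstar_algebra S R\<^esub>}"
  obtains q where "cstar_seminorm_on S q" "\<And>r. r \<in> R \<Longrightarrow> q r = 0" "q 1 = 1"
proof (rule ccontr)
  let ?Q = "{q. cstar_seminorm_on S q \<and> (\<forall>r\<in>R. q r = 0)}"
  note witness = that
  assume no: "\<not> thesis"
  have "q u = 0" if "q \<in> ?Q" "u \<in> free_star_algebra S" for q u
    using that no witness[of q] cstar_seminorm.q_one[of S q u] by (auto simp: cstar_seminorm_def)
  \<comment> \<open>The supremum over the admissible seminorms has to run over a nonempty set in
    order to be 0.\<close>
  moreover have "(\<lambda>_. 0) \<in> ?Q"
    by (simp add: cstar_seminorm_on_def)
  ultimately have "(\<lambda>q. q u) ` ?Q = {0}" if "u \<in> free_star_algebra S" for u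
    using that by (auto simp: image_iff)
  then have univ: "universal_seminorm S R u = 0" if "u \<in> free_star_algebra S" for u
    using that by (simp add: universal_seminorm_def)
  have seqs: "cauchy_seqs S R = {s. range s \<subseteq> free_star_algebra S}"
    by (auto simp: cauchy_seqs_def univ image_subset_iff)
  have "cauchy_rel S R = cauchy_seqs S R \<times> cauchy_seqs S R"
    by (auto simp: cauchy_rel_def seqs univ image_subset_iff)
  then have "cauchy_rel S R `` {s} = cauchy_seqs S R" if "s \<in> cauchy_seqs S R" for s
    using that by auto
  moreover have "(\<lambda>n. 0) \<in> cauchy_seqs S R"
    by (auto simp: seqs)
  ultimately have "cauchy_seqs S R // cauchy_rel S R = {cauchy_class S R (\<lambda>n. 0)}"
    by (auto simp: quotient_def cauchy_class_def)
  then show False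
    using assms by (simp add: universal_cstar_algebra_def)
qed

text \<open>The universal seminorm of the difference of 0 and 1 is at least its value under
  \<open>q\<close>, namely 1, so the two constant sequences are not equivalent.\<close>

lemma universal_cstar_algebra_nontrivialI:
  assumes "cstar_seminorm_on S q" "\<And>r. r \<in> R \<Longrightarrow> q r = 0" "q 1 \<noteq> 0"
  shows "carrier (universal_cstar_algebra S R) \<noteq> {\<zero>\<^bsub>universal_cstar_algebra S R\<^esub>}"
proof
  let ?Q = "{q. cstar_seminorm_on S q \<and> (\<forall>r\<in>R. q r = 0)}"
  let ?one = "\<lambda>n. 1"
  assume triv: "carrier (universal_cstar_algebra S R) = {\<zero>\<^bsub>universal_cstar_algebra S R\<^esub>}"
  have q: "q \<in> ?Q"
    using assms by simp
  have seminorm: "cstar_seminorm S p" if "p \<in> ?Q" for p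
    using that by (simp add: cstar_seminorm_def)
  have "(\<lambda>p. p 0) ` ?Q = {0}"
    using q cstar_seminorm.q_zero[OF seminorm] by (auto simp: image_iff)
  then have univ0: "universal_seminorm S R 0 = 0"
    by (simp add: universal_seminorm_def)
  \<comment> \<open>Comparing the constant sequence 0 with 1 produces the difference
    \<open>0 - 1\<close>. Every admissible seminorm takes the value 0 or 1 there, so the real
    supremum is bounded and dominates the value of \<open>q\<close>.\<close>
  have neg_one: "p (- 1) = p 1" if "p \<in> ?Q" for p
    using cstar_seminorm.q_uminus[OF seminorm[OF that], of 1] by simp
  have "p (- 1) \<le> 1" if "p \<in> ?Q" for p
    using cstar_seminorm.q_one_cases[OF seminorm[OF that]] neg_one[OF that] by auto
  then have "bdd_above ((\<lambda>p. p (- 1)) ` ?Q)"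
    by (rule bdd_aboveI2)
  then have "q (- 1) \<le> universal_seminorm S R (- 1)"
    unfolding universal_seminorm_def by (intro cSUP_upper q)
  moreover have "q 1 = 1"
    using cstar_seminorm.q_one_cases[OF seminorm[OF q]] assms(3) by simp
  ultimately have univ1: "1 \<le> universal_seminorm S R (- 1)"
    using neg_one[OF q] by simp
  have "?one \<in> cauchy_seqs S R"
    by (auto simp: cauchy_seqs_def univ0)
  have "cauchy_class S R ?one \<in> carrier (universal_cstar_algebra S R)"
    using \<open>?one \<in> cauchy_seqs S R\<close>
    by (simp add: universal_cstar_algebra_def cauchy_class_def quotientI)
  then have "cauchy_class S R ?one = cauchy_class S R (\<lambda>n. 0)"
    unfolding triv by (simp add: universal_cstar_algebra_def)
  moreover have "?one \<in> cauchy_class S R ?one"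
    using \<open>?one \<in> cauchy_seqs S R\<close> by (simp add: cauchy_class_def cauchy_rel_def univ0)
  ultimately have "?one \<in> cauchy_class S R (\<lambda>n. 0)"
    by simp
  then have "((\<lambda>n. 0), ?one) \<in> cauchy_rel S R"
    by (simp add: cauchy_class_def)
  then have "(\<lambda>n::nat. universal_seminorm S R (- 1)) \<longlonglongrightarrow> 0"
    by (simp add: cauchy_rel_def)
  then show False
    using univ1 by (simp add: LIMSEQ_const_iff)
qed

section \<open>Bounds on the orthogonal rank\<close>

text \<open>Extended naturals are well-ordered, so a nonempty set of admissible cardinalities
  attains its infimum.\<close>

lemma cstar_orthogonal_rank_cases:
  fixes G :: "('v, 'e) pre_digraph"
  obtains (infinite) "cstar_orthogonal_rank G = \<infinity>"
  | (finite) A :: "nat set" where "finite A" "A \<noteq> {}" "cstar_orthogonal_rank G = enat (card A)"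
    "carrier (graph_cstar_algebra G A) \<noteq> {\<zero>\<^bsub>graph_cstar_algebra G A\<^esub>}"
proof -
  let ?X = "{enat (card A) | A :: nat set. finite A \<and> A \<noteq> {} \<and>
      carrier (graph_cstar_algebra G A) \<noteq> {\<zero>\<^bsub>graph_cstar_algebra G A\<^esub>}}"
  show thesis
  proof (cases "?X = {}")
    case True
    then show thesis
      using infinite by (simp add: cstar_orthogonal_rank_def Inf_enat_def)
  next
    case False
    then obtain k where "k \<in> ?X"
      by (auto simp only: ex_in_conv[symmetric])
    then have "Inf ?X \<in> ?X"
      by (rule wellorder_InfI)
    then obtain A :: "nat set" where "Inf ?X = enat (card A)" "finite A" "A \<noteq> {}"
      "carrier (graph_cstar_algebra G A) \<noteq> {\<zero>\<^bsub>graph_cstar_algebra G A\<^esub>}"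
      by blast
    then show thesis
      using finite[of A] unfolding cstar_orthogonal_rank_def by blast
  qed
qed

lemma sum_handle_squares_le_rank:
  fixes G :: "('v, 'e) pre_digraph"
  assumes "finite (verts G)" "orthonormal_representation G N u"
    and "c \<in> carrier_vec N" "scalar_prod c c = 1" and "cstar_orthogonal_rank G = enat k"
  shows "0 < k \<and> (\<Sum>x\<in>verts G. (scalar_prod c (u x))\<^sup>2) \<le> (real k)\<^sup>2"
proof (cases G rule: cstar_orthogonal_rank_cases)
  case (finite A)
  obtain q where "cstar_seminorm_on (matrix_gens G A) q"
    "\<And>r. r \<in> matrix_unit_relators G A \<union> orthogonality_relators G A \<Longrightarrow> q r = 0" "q 1 = 1"
    using universal_cstar_algebra_nontrivialD finite(4) unfolding graph_cstar_algebra_def by blast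
  then interpret graph_cstar_seminorm G A q
    using assms(1) finite by unfold_locales auto
  show ?thesis
    using sum_handle_squares_le[OF assms(2-4)] finite assms(5) by (simp add: card_gt_0_iff)
qed (use assms(5) in simp)

text \<open>An orthonormal basis indexed by the vertices, with the normalised all-ones vector as
  handle. It makes the set in \<open>lovasz_number\<close> nonempty, as the real infimum
  requires.\<close>

lemma ex_orthonormal_representation:
  fixes G :: "('v, 'e) pre_digraph"
  assumes fin: "finite (verts G)" and ne: "verts G \<noteq> {}"
  obtains N c u where "orthonormal_representation G N u" "c \<in> carrier_vec N" "scalar_prod c c = 1"
    "\<And>x. x \<in> verts G \<Longrightarrow> scalar_prod c (u x) \<noteq> 0"
proof -
  define n where "n = card (verts G)"
  have n: "0 < n"
    using fin ne by (simp add: n_def card_gt_0_iff)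
  obtain h where h: "bij_betw h (verts G) {0..<n}"
    using ex_bij_betw_finite_nat[OF fin] by (auto simp: n_def)
  let ?u = "\<lambda>x. unit_vec n (h x) :: real vec"
  let ?c = "vec n (\<lambda>_. 1 / sqrt n) :: real vec"
  have hn: "h x < n" if "x \<in> verts G" for x
    using bij_betwE[OF h] that by auto
  have "orthonormal_representation G n ?u"
    using hn bij_betw_imp_inj_on[OF h] by (auto simp: orthonormal_representation_def dest: inj_onD)
  moreover have "scalar_prod ?c ?c = 1"
    using n by (simp add: scalar_prod_def)
  moreover have "scalar_prod ?c (?u x) \<noteq> 0" if "x \<in> verts G" for x
    using n hn[OF that] by simp
  ultimately show thesis
    by (intro that[of n ?u ?c]) auto
qed

text \<open>If \<theta> is the value of a representation, each vertex satisfies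
  \<open>1 \<le> \<theta> * (scalar_prod c (u x))\<^sup>2\<close>. Summing and applying the Bessel
  bound makes \<open>n / (real k)\<^sup>2\<close> a lower bound for all \<theta>, hence for their
  infimum.\<close>

lemma sqrt_card_div_lovasz_number_le:
  fixes G :: "('v, 'e) pre_digraph"
  assumes fin: "finite (verts G)" and rank: "cstar_orthogonal_rank G = enat k"
  shows "sqrt (real (card (verts G)) / lovasz_number G) \<le> real k"
proof (cases "verts G = {}")
  case False
  define n where "n = real (card (verts G))"
  let ?\<Theta> = "{Max ((\<lambda>x. 1 / (scalar_prod c (u x))\<^sup>2) ` verts G) | N c u.
      orthonormal_representation G N u \<and> c \<in> carrier_vec N \<and> scalar_prod c c = 1 \<and>
      (\<forall>x\<in>verts G. scalar_prod c (u x) \<noteq> 0)}"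
  have n: "0 < n"
    using fin False by (simp add: n_def card_gt_0_iff)
  obtain N c u where rep: "orthonormal_representation G N u" "c \<in> carrier_vec N"
    "scalar_prod c c = 1" "\<And>x. x \<in> verts G \<Longrightarrow> scalar_prod c (u x) \<noteq> 0"
    by (rule ex_orthonormal_representation[OF fin False]) (rule that)
  then have k: "0 < k"
    using sum_handle_squares_le_rank[OF fin rep(1-3) rank] by simp
  have "?\<Theta> \<noteq> {}"
    using rep by blast
  moreover have "n / (real k)\<^sup>2 \<le> \<theta>" if "\<theta> \<in> ?\<Theta>" for \<theta>
  proof -
    obtain N c u where \<theta>: "\<theta> = Max ((\<lambda>x. 1 / (scalar_prod c (u x))\<^sup>2) ` verts G)"
      and rep: "orthonormal_representation G N u" "c \<in> carrier_vec N" "scalar_prod c c = 1"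
      and nz: "\<forall>x\<in>verts G. scalar_prod c (u x) \<noteq> 0"
      using \<open>\<theta> \<in> ?\<Theta>\<close> by blast
    have le: "1 / (scalar_prod c (u x))\<^sup>2 \<le> \<theta>" if "x \<in> verts G" for x
      unfolding \<theta> using that fin by (intro Max_ge) auto
    obtain x0 where "x0 \<in> verts G"
      using False by blast
    then have \<theta>_pos: "0 < \<theta>"
      using le[of x0] nz by (smt (verit) zero_less_divide_1_iff zero_less_power2)
    have "n = (\<Sum>x\<in>verts G. 1)"
      by (simp add: n_def)
    also have "\<dots> \<le> (\<Sum>x\<in>verts G. \<theta> * (scalar_prod c (u x))\<^sup>2)"
      using le nz by (intro sum_mono) (simp add: field_simps)
    also have "\<dots> \<le> \<theta> * (real k)\<^sup>2"
      unfolding sum_distrib_left[symmetric]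
      using sum_handle_squares_le_rank[OF fin rep rank] \<theta>_pos by (intro mult_left_mono) auto
    finally show ?thesis
      using k by (simp add: field_simps)
  qed
  ultimately have "n / (real k)\<^sup>2 \<le> lovasz_number G"
    unfolding lovasz_number_def by (rule cInf_greatest)
  \<comment> \<open>A positive lower bound makes the Lovasz number positive, so the inequality can
    be solved for the quotient.\<close>
  moreover have "0 < n / (real k)\<^sup>2"
    using n k by simp
  ultimately have "0 < lovasz_number G" "n / (real k)\<^sup>2 \<le> lovasz_number G"
    by simp_all
  then have "n / lovasz_number G \<le> (real k)\<^sup>2"
    using k by (simp add: field_simps)
  then show ?thesis
    unfolding n_def by (rule real_le_lsqrt[rotated]) simp
\<comment> \<open>Without vertices the numerator is 0, so the unspecified Lovasz number does not
  matter.\<close>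
qed simp

section \<open>The rank of complete graphs\<close>

lemma cstar_orthogonal_rank_complete_digraph_ge:
  fixes K :: "('v, 'e) pre_digraph"
  assumes K: "complete_digraph (d\<^sup>2) K"
  shows "enat d \<le> cstar_orthogonal_rank K"
proof (cases "cstar_orthogonal_rank K")
  case (enat k)
  interpret graph K
    using K by (simp add: complete_digraph_def)
  \<comment> \<open>Distinct vertices are all adjacent, so a constant unit vector is allowed. With
    the same vector as handle each of the \<open>d\<^sup>2\<close> terms in the Bessel bound is 1,
    without passing through the Lovasz number.\<close>
  have "orthonormal_representation K 1 (\<lambda>_. unit_vec 1 0)"
    using K by (auto simp: orthonormal_representation_def complete_digraph_def)
  from sum_handle_squares_le_rank[OF finite_verts this _ _ enat, of "unit_vec 1 0"]
  have "(real d)\<^sup>2 \<le> (real k)\<^sup>2"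
    using K by (simp add: complete_digraph_def)
  then show ?thesis
    using enat by (simp add: power2_le_iff_abs_le)
qed simp

text \<open>The \<open>d\<^sup>2\<close> vertices are matched with the pairs of shift and phase.
  Adjacent vertices are distinct, so their Weyl unitaries are trace-orthogonal and the algebra for
  \<open>{..<d}\<close> is nonzero.\<close>

lemma cstar_orthogonal_rank_complete_digraph_le:
  fixes K :: "('v, 'e) pre_digraph"
  assumes K: "complete_digraph (d\<^sup>2) K" and d: "1 \<le> d"
  shows "cstar_orthogonal_rank K \<le> enat d"
proof -
  interpret graph K
    using K by (simp add: complete_digraph_def)
  have card: "card (verts K) = card ({..<d} \<times> {..<d})"
    using K by (simp add: complete_digraph_def card_cartesian_product power2_eq_square)
  obtain h where h: "bij_betw h (verts K) ({..<d} \<times> {..<d})"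
    using finite_same_card_bij[OF finite_verts _ card] by auto
  have hv: "h x \<in> {..<d} \<times> {..<d}" if "x \<in> verts K" for x
    using bij_betwE[OF h] that by blast
  have "h x \<noteq> h y" if "x \<in> verts K" "y \<in> verts K" "x \<rightarrow>\<^bsub>K\<^esub> y" for x y
    using K that bij_betw_imp_inj_on[OF h] by (auto simp: complete_digraph_def dest: inj_onD)
  then obtain q where "cstar_seminorm_on (matrix_gens K {..<d}) q"
    "\<And>r. r \<in> matrix_unit_relators K {..<d} \<union> orthogonality_relators K {..<d} \<Longrightarrow> q r = 0" "q 1 \<noteq> 0"
    using ex_seminorm_of_orthogonal_unitaries[of "{..<d}" K "\<lambda>x. weyl d (h x)"] d hv
    by (auto simp: weyl_cols weyl_rows weyl_trace_orthogonal lessThan_empty_iff)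
  then have "carrier (graph_cstar_algebra K {..<d}) \<noteq> {\<zero>\<^bsub>graph_cstar_algebra K {..<d}\<^esub>}"
    unfolding graph_cstar_algebra_def by (rule universal_cstar_algebra_nontrivialI)
  then have "Inf {enat (card A) | A :: nat set. finite A \<and> A \<noteq> {} \<and>
      carrier (graph_cstar_algebra K A) \<noteq> {\<zero>\<^bsub>graph_cstar_algebra K A\<^esub>}} \<le> enat (card {..<d})"
    using d by (intro Inf_lower CollectI exI[of _ "{..<d}"]) (auto simp: lessThan_empty_iff)
  then show ?thesis
    by (simp add: cstar_orthogonal_rank_def)
qed

theorem proposition5p16:
  fixes G :: "('v, 'e) pre_digraph"
  assumes "graph G"
  shows "ereal_of_enat (cstar_orthogonal_rank G)
           \<ge> ereal (sqrt (real (card (verts G)) / lovasz_number G)) \<and>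
         (\<forall>d\<ge>1. \<forall>K :: ('w, 'f) pre_digraph.
           complete_digraph (d\<^sup>2) K \<longrightarrow> cstar_orthogonal_rank K = enat d)"
proof (intro conjI allI impI)
  interpret graph G
    by fact
  show "ereal (sqrt (real (card (verts G)) / lovasz_number G)) \<le> ereal_of_enat (cstar_orthogonal_rank G)"
    using sqrt_card_div_lovasz_number_le[OF finite_verts]
    by (cases "cstar_orthogonal_rank G") auto
qed (intro order.antisym cstar_orthogonal_rank_complete_digraph_le
    cstar_orthogonal_rank_complete_digraph_ge)

end
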